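(* Let $f\in\mathbb C[x_1,\dots,x_n]$ and $g\in\mathbb C[y_1,\dots,y_m]$ be non-zero polynomials in disjoint sets of variables, and regard $f\cdot g$ as an element of $\mathbb C[x_1,\dots,x_n,y_1,\dots,y_m]$. Then $$b_f(s)\cdot b_g(s)=b_{f\cdot g}(s).$$
   Context: For a non-zero polynomial $h\in\mathbb C[z_1,\dots,z_N]$, let $A_N(\mathbb C)=\mathbb C[z_1,\dots,z_N]\langle\partial_{z_1},\dots,\partial_{z_N}\rangle$ be the Weyl algebra, $s$ a variable and $h^s$ a formal symbol. The free rank-one module $\mathbb C[z_1,\dots,z_N][\frac1h][s]\cdot h^s$ is a left $A_N(\mathbb C)[s]$-module with polynomials acting by multiplication and $\partial_{z_i}(a h^s)=\left(\frac{\partial a}{\partial z_i}+s\,a\,\frac{\partial h/\partial z_i}{h}\right)h^s$. Write $h^{s+1}:=h\cdot h^s$. The Bernstein-Sato polynomial $b_h(s)\in\mathbb C[s]$ is the non-zero monic polynomial of minimal degree such that $b_h(s)\cdot h^s=P\cdot h^{s+1}$ for some $P\in A_N(\mathbb C)[s]$ (it exists). Here $b_f$, $b_g$, $b_{f\cdot g}$ are taken in the polynomial rings in $n$, $m$ and $n+m$ variables respectively. *)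

theory Defs
  imports "HOL-Library.Poly_Mapping" "HOL-Computational_Algebra.Computational_Algebra" Complex_Main
begin

section \<open>Polynomials in several variables\<close>

text \<open>
  The variables are \<open>z i\<close> with \<open>i :: nat\<close>. A polynomial ring in finitely many variables is
  the subring \<open>polys X\<close> of \<open>\<complex>[z i. i :: nat]\<close> for a finite index set \<open>X\<close>, so that rings
  in disjoint sets of variables and the ring in all of these variables live in one type.
\<close>

type_synonym mpoly = "(nat \<Rightarrow>\<^sub>0 nat) \<Rightarrow>\<^sub>0 complex"

definition polys :: "nat set \<Rightarrow> mpoly set" where
  "polys X = {p. \<forall>m \<in> Poly_Mapping.keys p. Poly_Mapping.keys m \<subseteq> X}"

definition mvar :: "nat \<Rightarrow> mpoly" where
  "mvar i = Poly_Mapping.single (Poly_Mapping.single i 1) 1"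

definition mconst :: "complex \<Rightarrow> mpoly" where
  "mconst c = Poly_Mapping.single 0 c"

text \<open>The partial derivative, given by its coefficient at each monomial \<open>m\<close>.\<close>

lift_definition mpderiv :: "nat \<Rightarrow> mpoly \<Rightarrow> mpoly"
  is "\<lambda>i p m. of_nat (Suc (Poly_Mapping.lookup m i)) * p (m + Poly_Mapping.single i 1)"
proof -
  fix i :: nat and p :: "(nat \<Rightarrow>\<^sub>0 nat) \<Rightarrow> complex"
  let ?e = "Poly_Mapping.single i 1 :: nat \<Rightarrow>\<^sub>0 nat"
  assume "finite {m. p m \<noteq> 0}"
  then have "finite ((\<lambda>m. m + ?e) -` {m. p m \<noteq> 0})"
    by (rule finite_vimageI) (simp add: inj_on_def)
  then show "finite {m. of_nat (Suc (Poly_Mapping.lookup m i)) * p (m + ?e) \<noteq> 0}"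
    by (rule rev_finite_subset) auto
qed

lemma mpoly_induct [case_names single add]:
  fixes p :: mpoly
  assumes "\<And>m c. P (Poly_Mapping.single m c)" and "\<And>p q. P p \<Longrightarrow> P q \<Longrightarrow> P (p + q)"
  shows "P p"
proof -
  have eq: "p = (\<Sum>m \<in> Poly_Mapping.keys p. Poly_Mapping.single m (Poly_Mapping.lookup p m))"
    by (rule poly_mapping_eqI)
      (auto simp: lookup_sum lookup_single when_def in_keys_iff sum.delta)
  have "P (\<Sum>m \<in> A. Poly_Mapping.single m (Poly_Mapping.lookup p m))" if "finite A" for A
    using that
  proof (induction A rule: finite_induct)
    case empty
    show ?case using assms(1)[of 0 0] by simp
  next
    case (insert x F)
    then show ?case by (simp add: assms)
  qed
  from this[OF finite_keys] show ?thesis by (subst eq)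
qed

lemma mpderiv_add [simp]: "mpderiv i (p + q) = mpderiv i p + mpderiv i q"
  by (rule poly_mapping_eqI) (simp add: mpderiv.rep_eq lookup_add algebra_simps)

lemma mpderiv_single:
  "mpderiv i (Poly_Mapping.single m c) =
    Poly_Mapping.single (m - Poly_Mapping.single i 1) (of_nat (Poly_Mapping.lookup m i) * c)"
proof (rule poly_mapping_eqI)
  fix k
  let ?e = "Poly_Mapping.single i 1 :: nat \<Rightarrow>\<^sub>0 nat"
  show "Poly_Mapping.lookup (mpderiv i (Poly_Mapping.single m c)) k =
    Poly_Mapping.lookup (Poly_Mapping.single (m - ?e) (of_nat (Poly_Mapping.lookup m i) * c)) k"
  proof (cases "Poly_Mapping.lookup m i = 0")
    case True
    then have "m \<noteq> k + ?e" by (auto simp: lookup_add)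
    with True show ?thesis by (simp add: mpderiv.rep_eq lookup_single)
  next
    case False
    then have "m = (m - ?e) + ?e"
      by (intro poly_mapping_eqI) (auto simp: lookup_add lookup_minus lookup_single when_def)
    then obtain n where n: "m = n + ?e" by blast
    then show ?thesis by (simp add: mpderiv.rep_eq lookup_single lookup_add when_def)
  qed
qed

lemma mpderiv_mult: "mpderiv i (p * q) = mpderiv i p * q + p * mpderiv i q"
proof (induction p rule: mpoly_induct)
  case (single m c)
  show ?case
  proof (induction q rule: mpoly_induct)
    case (single n d)
    let ?e = "Poly_Mapping.single i 1 :: nat \<Rightarrow>\<^sub>0 nat"
    have m: "m - ?e + n = m + n - ?e" if "Poly_Mapping.lookup m i \<noteq> 0"
      using that
      by (intro poly_mapping_eqI) (auto simp: lookup_add lookup_minus lookup_single when_def)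
    have n: "m + (n - ?e) = m + n - ?e" if "Poly_Mapping.lookup n i \<noteq> 0"
      using that
      by (intro poly_mapping_eqI) (auto simp: lookup_add lookup_minus lookup_single when_def)
    show ?case
      using m n
      by (cases "Poly_Mapping.lookup m i = 0"; cases "Poly_Mapping.lookup n i = 0")
        (simp_all add: mpderiv_single mult_single lookup_add algebra_simps flip: single_add)
  next
    case (add p q)
    then show ?case by (simp add: algebra_simps)
  qed
next
  case (add p q)
  then show ?case by (simp add: algebra_simps)
qed

lemma mpderiv_commute: "mpderiv i (mpderiv j p) = mpderiv j (mpderiv i p)"
  by (rule poly_mapping_eqI)
    (cases "i = j", simp_all add: mpderiv.rep_eq lookup_add lookup_single add_ac mult_ac)

lemma mpderiv_0 [simp]: "mpderiv i 0 = 0"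
  by (rule poly_mapping_eqI) (simp add: mpderiv.rep_eq)

lemma mpderiv_mconst [simp]: "mpderiv i (mconst c) = 0"
  by (simp add: mconst_def mpderiv_single)

lemma mpderiv_1 [simp]: "mpderiv i 1 = 0"
  using mpderiv_mconst[of i 1] by (simp add: mconst_def)

lemma mpderiv_mvar: "mpderiv i (mvar j) = (if i = j then 1 else 0)"
  by (simp add: mvar_def mpderiv_single lookup_single)

lemma mpderiv_uminus [simp]: "mpderiv i (- p) = - mpderiv i p"
  by (rule poly_mapping_eqI) (simp add: mpderiv.rep_eq)

lemma mpderiv_diff [simp]: "mpderiv i (p - q) = mpderiv i p - mpderiv i q"
  using mpderiv_add[of i p "- q"] by simp

lemma mconst_0 [simp]: "mconst 0 = 0"
  by (simp add: mconst_def)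

lemma mconst_1 [simp]: "mconst 1 = 1"
  by (simp add: mconst_def)

lemma mconst_add: "mconst (a + b) = mconst a + mconst b"
  by (simp add: mconst_def single_add)

lemma mconst_uminus: "mconst (- a) = - mconst a"
  by (simp add: mconst_def single_uminus)

lemma mconst_diff: "mconst (a - b) = mconst a - mconst b"
  by (simp add: mconst_def single_diff)

lemma mconst_mult: "mconst (a * b) = mconst a * mconst b"
  by (simp add: mconst_def mult_single)

lemma mconst_eq_0_iff [simp]: "mconst c = 0 \<longleftrightarrow> c = 0"
  by (metis mconst_def lookup_single_eq lookup_zero single_zero)

lemma polys_add: "p \<in> polys X \<Longrightarrow> q \<in> polys X \<Longrightarrow> p + q \<in> polys X"
  unfolding polys_def using keys_add[of p q] by fastforce

lemma polys_mult: "p \<in> polys X \<Longrightarrow> q \<in> polys X \<Longrightarrow> p * q \<in> polys X"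
  unfolding polys_def using keys_mult[of p q] by (fastforce dest: subsetD[OF keys_add])

lemma polys_uminus: "p \<in> polys X \<Longrightarrow> - p \<in> polys X"
  by (simp add: polys_def in_keys_iff)

lemma polys_diff: "p \<in> polys X \<Longrightarrow> q \<in> polys X \<Longrightarrow> p - q \<in> polys X"
  using polys_add[of p X "- q"] polys_uminus by simp

lemma polys_mconst [simp]: "mconst c \<in> polys X"
  by (simp add: polys_def mconst_def)

lemma polys_1 [simp]: "1 \<in> polys X"
  using polys_mconst[of 1] by simp

lemma polys_mvar: "i \<in> X \<Longrightarrow> mvar i \<in> polys X"
  by (simp add: polys_def mvar_def)

lemma polys_power: "p \<in> polys X \<Longrightarrow> p ^ k \<in> polys X"
  by (induction k) (simp_all add: polys_mult)

lemma polys_mono: "X \<subseteq> Y \<Longrightarrow> polys X \<subseteq> polys Y"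
  by (auto simp: polys_def)

lemma polys_mpderiv:
  assumes "p \<in> polys X"
  shows "mpderiv i p \<in> polys X"
  unfolding polys_def
proof (intro CollectI ballI)
  fix m assume "m \<in> Poly_Mapping.keys (mpderiv i p)"
  then have "m + Poly_Mapping.single i 1 \<in> Poly_Mapping.keys p"
    by (auto simp: in_keys_iff mpderiv.rep_eq)
  with assms have "Poly_Mapping.keys (m + Poly_Mapping.single i 1) \<subseteq> X"
    by (auto simp: polys_def)
  then show "Poly_Mapping.keys m \<subseteq> X"
    by (force simp: in_keys_iff lookup_add)
qed


section \<open>The module generated by \<open>h\<^sup>s\<close>\<close>

text \<open>
  The localisations \<open>\<complex>[z i. i \<in> X][1/h]\<close> are taken inside the fraction field of
  \<open>\<complex>[z i. i :: nat]\<close>, to which the partial derivatives extend by the quotient rule.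
\<close>

definition fract_pderiv :: "nat \<Rightarrow> mpoly fract \<Rightarrow> mpoly fract" where
  "fract_pderiv i x = (THE y. \<exists>a b. b \<noteq> 0 \<and> x = Fract a b \<and>
     y = Fract (mpderiv i a * b - a * mpderiv i b) (b * b))"

lemma fract_pderiv_Fract:
  assumes "b \<noteq> 0"
  shows "fract_pderiv i (Fract a b) = Fract (mpderiv i a * b - a * mpderiv i b) (b * b)"
  unfolding fract_pderiv_def
proof (rule the_equality)
  show "\<exists>a' b'. b' \<noteq> 0 \<and> Fract a b = Fract a' b' \<and>
      Fract (mpderiv i a * b - a * mpderiv i b) (b * b) =
      Fract (mpderiv i a' * b' - a' * mpderiv i b') (b' * b')"
    using assms by blast
next
  fix y
  assume "\<exists>a' b'. b' \<noteq> 0 \<and> Fract a b = Fract a' b' \<and>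
      y = Fract (mpderiv i a' * b' - a' * mpderiv i b') (b' * b')"
  then obtain c d where d: "d \<noteq> 0" and eq: "Fract a b = Fract c d"
    and y: "y = Fract (mpderiv i c * d - c * mpderiv i d) (d * d)"
    by blast
  have e: "a * d = c * b"
    using eq assms d by (simp add: eq_fract)
  then have "mpderiv i (a * d) = mpderiv i (c * b)" by simp
  then have e': "mpderiv i a * d + a * mpderiv i d = mpderiv i c * b + c * mpderiv i b"
    by (simp add: mpderiv_mult)
  have "(mpderiv i a * b - a * mpderiv i b) * (d * d) =
      (mpderiv i c * d - c * mpderiv i d) * (b * b)"
    using e e' by algebra
  with assms d y show "y = Fract (mpderiv i a * b - a * mpderiv i b) (b * b)"
    by (simp add: eq_fract)
qed

lemma fract_pderiv_to_fract [simp]: "fract_pderiv i (to_fract a) = to_fract (mpderiv i a)"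
  by (simp add: to_fract_def fract_pderiv_Fract)

lemma fract_pderiv_0 [simp]: "fract_pderiv i 0 = 0"
  using fract_pderiv_to_fract[of i 0] by simp

lemma fract_pderiv_add: "fract_pderiv i (x + y) = fract_pderiv i x + fract_pderiv i y"
proof (cases x; cases y)
  fix a b c d
  assume *: "x = Fract a b" "b \<noteq> 0" "y = Fract c d" "d \<noteq> 0"
  have "((mpderiv i a * d + a * mpderiv i d + (mpderiv i c * b + c * mpderiv i b)) * (b * d)
      - (a * d + c * b) * (mpderiv i b * d + b * mpderiv i d)) * (b * b * (d * d))
    = ((mpderiv i a * b - a * mpderiv i b) * (d * d) + (mpderiv i c * d - c * mpderiv i d) * (b * b))
      * (b * d * (b * d))"
    by algebra
  with * show ?thesis
    by (simp only: fract_pderiv_Fract add_fract eq_fract mpderiv_mult mpderiv_add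
        mult_eq_0_iff simp_thms)
qed

lemma fract_pderiv_mult:
  "fract_pderiv i (x * y) = fract_pderiv i x * y + x * fract_pderiv i y"
proof (cases x; cases y)
  fix a b c d
  assume *: "x = Fract a b" "b \<noteq> 0" "y = Fract c d" "d \<noteq> 0"
  have "((mpderiv i a * c + a * mpderiv i c) * (b * d) - a * c * (mpderiv i b * d + b * mpderiv i d))
      * (b * b * d * (b * (d * d)))
    = ((mpderiv i a * b - a * mpderiv i b) * c * (b * (d * d))
        + a * (mpderiv i c * d - c * mpderiv i d) * (b * b * d)) * (b * d * (b * d))"
    by algebra
  with * show ?thesis
    by (simp only: fract_pderiv_Fract add_fract mult_fract eq_fract mpderiv_mult
        mult_eq_0_iff simp_thms)
qed

lemma fract_pderiv_commute:
  "fract_pderiv i (fract_pderiv j x) = fract_pderiv j (fract_pderiv i x)"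
proof (cases x)
  case (Fract a b)
  let ?b = "to_fract b" and ?D = fract_pderiv
  have b: "?b \<noteq> 0" and x: "x * ?b = to_fract a"
    using Fract by (simp_all add: Fract_conv_to_fract)
  have "?D i (?D j (x * ?b)) = ?D j (?D i (x * ?b))"
    by (simp add: x mpderiv_commute)
  then have "?D i (?D j x) * ?b = ?D j (?D i x) * ?b"
    by (simp add: fract_pderiv_mult fract_pderiv_add mpderiv_commute[of i j])
  with b show ?thesis by simp
qed

text \<open>
  A polynomial \<open>u\<close> in \<open>s\<close> with coefficients in the fraction field stands for \<open>u \<cdot> h\<^sup>s\<close>. The
  module \<open>\<complex>[z i. i \<in> X][1/h][s] \<cdot> h\<^sup>s\<close> is \<open>hs_module X h\<close>; it contains \<open>b(s) \<cdot> h\<^sup>s\<close>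
  and \<open>h\<^bsup>s+1\<^esup>\<close> and is stable under the operators below (lemma \<open>hs_module_act\<close>).
\<close>

definition localization :: "nat set \<Rightarrow> mpoly \<Rightarrow> mpoly fract set" where
  "localization X h = {to_fract a / to_fract h ^ k | a k. a \<in> polys X}"

definition hs_module :: "nat set \<Rightarrow> mpoly \<Rightarrow> mpoly fract poly set" where
  "hs_module X h = {u. \<forall>k. coeff u k \<in> localization X h}"

definition hs_deriv :: "mpoly \<Rightarrow> nat \<Rightarrow> mpoly fract poly \<Rightarrow> mpoly fract poly" where
  "hs_deriv h i u = map_poly (fract_pderiv i) u
     + [:0, 1:] * u * [:to_fract (mpderiv i h) / to_fract h:]"

lemma coeff_hs_deriv:
  "coeff (hs_deriv h i u) k = fract_pderiv i (coeff u k)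
     + (if k = 0 then 0 else coeff u (k - 1) * (to_fract (mpderiv i h) / to_fract h))"
  by (cases k) (simp_all add: hs_deriv_def coeff_map_poly coeff_pCons mult.commute)


section \<open>The Weyl algebra with a central variable \<open>s\<close>\<close>

text \<open>
  \<open>A(\<complex>)[s]\<close> in the variables \<open>z i\<close>, \<open>i :: nat\<close>, is the unital associative
  \<open>\<complex>\<close>-algebra presented by generators \<open>z i\<close>, \<open>\<partial> i\<close>, \<open>s\<close> and the relations
  \<open>[z i, z j] = 0\<close>, \<open>[\<partial> i, \<partial> j] = 0\<close>, \<open>[\<partial> i, z j] = \<delta>\<^sub>i\<^sub>j\<close>, \<open>s\<close> central: the
  expressions in the generators modulo the least congruence \<open>weyl_eq\<close> that contains these
  relations and makes the quotient such an algebra.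
\<close>

datatype weyl_expr =
    Const complex | Z nat | D nat | S
  | Plus weyl_expr weyl_expr | Times weyl_expr weyl_expr

inductive weyl_eq :: "weyl_expr \<Rightarrow> weyl_expr \<Rightarrow> bool" where
  refl: "weyl_eq a a"
| sym: "weyl_eq a b \<Longrightarrow> weyl_eq b a"
| trans: "weyl_eq a b \<Longrightarrow> weyl_eq b c \<Longrightarrow> weyl_eq a c"
| plus_cong: "weyl_eq a a' \<Longrightarrow> weyl_eq b b' \<Longrightarrow> weyl_eq (Plus a b) (Plus a' b')"
| times_cong: "weyl_eq a a' \<Longrightarrow> weyl_eq b b' \<Longrightarrow> weyl_eq (Times a b) (Times a' b')"
| plus_assoc: "weyl_eq (Plus (Plus a b) c) (Plus a (Plus b c))"
| plus_comm: "weyl_eq (Plus a b) (Plus b a)"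
| plus_zero: "weyl_eq (Plus (Const 0) a) a"
| plus_neg: "weyl_eq (Plus (Times (Const (- 1)) a) a) (Const 0)"
| times_assoc: "weyl_eq (Times (Times a b) c) (Times a (Times b c))"
| times_one_left: "weyl_eq (Times (Const 1) a) a"
| times_one_right: "weyl_eq (Times a (Const 1)) a"
| distrib_left: "weyl_eq (Times a (Plus b c)) (Plus (Times a b) (Times a c))"
| distrib_right: "weyl_eq (Times (Plus a b) c) (Plus (Times a c) (Times b c))"
| const_add: "weyl_eq (Const (x + y)) (Plus (Const x) (Const y))"
| const_mult: "weyl_eq (Const (x * y)) (Times (Const x) (Const y))"
| const_central: "weyl_eq (Times (Const x) a) (Times a (Const x))"
| S_central: "weyl_eq (Times S a) (Times a S)"
| Z_Z: "weyl_eq (Times (Z i) (Z j)) (Times (Z j) (Z i))"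
| D_D: "weyl_eq (Times (D i) (D j)) (Times (D j) (D i))"
| D_Z: "weyl_eq (Times (D i) (Z j)) (Plus (Times (Z j) (D i)) (Const (if i = j then 1 else 0)))"

primrec act_expr :: "mpoly \<Rightarrow> weyl_expr \<Rightarrow> mpoly fract poly \<Rightarrow> mpoly fract poly" where
  "act_expr h (Const c) u = smult (to_fract (mconst c)) u"
| "act_expr h (Z i) u = smult (to_fract (mvar i)) u"
| "act_expr h (D i) u = hs_deriv h i u"
| "act_expr h S u = [:0, 1:] * u"
| "act_expr h (Plus P Q) u = act_expr h P u + act_expr h Q u"
| "act_expr h (Times P Q) u = act_expr h P (act_expr h Q u)"

lemma hs_deriv_add: "hs_deriv h i (u + v) = hs_deriv h i u + hs_deriv h i v"
  by (rule poly_eqI) (simp add: coeff_hs_deriv fract_pderiv_add algebra_simps)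

lemma hs_deriv_smult:
  "hs_deriv h i (smult c u) = smult (fract_pderiv i c) u + smult c (hs_deriv h i u)"
  by (rule poly_eqI) (simp add: coeff_hs_deriv fract_pderiv_mult algebra_simps)

lemma hs_deriv_S: "hs_deriv h i ([:0, 1:] * u) = [:0, 1:] * hs_deriv h i u"
  by (rule poly_eqI) (simp add: coeff_hs_deriv coeff_pCons split: nat.split)

lemma fract_pderiv_log_commute:
  "fract_pderiv i (to_fract (mpderiv j h) / to_fract h) =
   fract_pderiv j (to_fract (mpderiv i h) / to_fract h)"
proof (cases "h = 0")
  case False
  then have "mpderiv i (mpderiv j h) * h - mpderiv j h * mpderiv i h =
      mpderiv j (mpderiv i h) * h - mpderiv i h * mpderiv j h"
    by (simp add: mpderiv_commute[of i j])
  with False show ?thesis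
    by (simp add: fract_pderiv_Fract mult.commute flip: Fract_conv_to_fract)
qed simp

lemma hs_deriv_commute: "hs_deriv h i (hs_deriv h j u) = hs_deriv h j (hs_deriv h i u)"
proof (rule poly_eqI)
  fix k
  define c where "c l = to_fract (mpderiv l h) / to_fract h" for l
  have "fract_pderiv i (c j) = fract_pderiv j (c i)"
    unfolding c_def by (rule fract_pderiv_log_commute)
  then show "coeff (hs_deriv h i (hs_deriv h j u)) k = coeff (hs_deriv h j (hs_deriv h i u)) k"
    unfolding coeff_hs_deriv c_def[symmetric]
    by (simp add: fract_pderiv_add fract_pderiv_mult fract_pderiv_commute[of i j] algebra_simps)
qed

lemma act_expr_add: "act_expr h P (u + v) = act_expr h P u + act_expr h P v"
  by (induction P arbitrary: u v) (simp_all add: smult_add_right hs_deriv_add algebra_simps)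

lemma act_expr_const:
  "act_expr h P (smult (to_fract (mconst c)) u) = smult (to_fract (mconst c)) (act_expr h P u)"
  by (induction P arbitrary: u)
    (simp_all add: smult_add_right hs_deriv_smult mult.commute)

lemma act_expr_S: "act_expr h P ([:0, 1:] * u) = [:0, 1:] * act_expr h P u"
proof (induction P arbitrary: u)
  case (D i)
  show ?case by (simp only: act_expr.simps hs_deriv_S)
qed (simp_all add: smult_add_right mult.commute algebra_simps)

lemma act_expr_cong: "weyl_eq P Q \<Longrightarrow> act_expr h P u = act_expr h Q u"
proof (induction arbitrary: u rule: weyl_eq.induct)
  case (S_central a)
  show ?case by (simp only: act_expr.simps act_expr_S)
next
  case (D_Z i j)
  show ?case by (simp add: hs_deriv_smult mpderiv_mvar)
qed (simp_all add: act_expr_add act_expr_const hs_deriv_commute mconst_add mconst_mult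
    smult_add_left mconst_uminus algebra_simps)

quotient_type weyl = weyl_expr / weyl_eq
  by (rule equivpI)
    (auto intro: reflpI sympI transpI weyl_eq.refl weyl_eq.sym weyl_eq.trans)

instantiation weyl :: ring_1
begin

lift_definition zero_weyl :: weyl is "Const 0" .
lift_definition one_weyl :: weyl is "Const 1" .
lift_definition plus_weyl :: "weyl \<Rightarrow> weyl \<Rightarrow> weyl" is Plus
  by (rule weyl_eq.plus_cong)
lift_definition times_weyl :: "weyl \<Rightarrow> weyl \<Rightarrow> weyl" is Times
  by (rule weyl_eq.times_cong)
lift_definition uminus_weyl :: "weyl \<Rightarrow> weyl" is "Times (Const (- 1))"
  by (intro weyl_eq.times_cong weyl_eq.refl)
definition minus_weyl :: "weyl \<Rightarrow> weyl \<Rightarrow> weyl" where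
  "minus_weyl a b = a + - b"

instance
proof
  fix a b c :: weyl
  show "a * b * c = a * (b * c)" by transfer (rule weyl_eq.times_assoc)
  show "a + b + c = a + (b + c)" by transfer (rule weyl_eq.plus_assoc)
  show "a + b = b + a" by transfer (rule weyl_eq.plus_comm)
  show "0 + a = a" by transfer (rule weyl_eq.plus_zero)
  show "- a + a = 0" by transfer (rule weyl_eq.plus_neg)
  show "a - b = a + - b" by (rule minus_weyl_def)
  show "1 * a = a" by transfer (rule weyl_eq.times_one_left)
  show "a * 1 = a" by transfer (rule weyl_eq.times_one_right)
  show "(a + b) * c = a * c + b * c" by transfer (rule weyl_eq.distrib_right)
  show "a * (b + c) = a * b + a * c" by transfer (rule weyl_eq.distrib_left)
  show "(0 :: weyl) \<noteq> 1"
  proof (transfer, rule notI)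
    assume "weyl_eq (Const 0) (Const 1)"
    from act_expr_cong[OF this, of 1 1] show False by simp
  qed
qed

end

lift_definition weyl_act :: "mpoly \<Rightarrow> weyl \<Rightarrow> mpoly fract poly \<Rightarrow> mpoly fract poly" is act_expr
  by (rule ext) (rule act_expr_cong)

lift_definition wconst :: "complex \<Rightarrow> weyl" is Const .
lift_definition wvar :: "nat \<Rightarrow> weyl" is Z .
lift_definition wderiv :: "nat \<Rightarrow> weyl" is D .
lift_definition wS :: weyl is S .

text \<open>
  The subalgebra generated by \<open>s\<close> and the \<open>z i\<close>, \<open>\<partial> i\<close> with \<open>i \<in> X\<close>, which for
  \<open>card X = N\<close> is a copy of the Weyl algebra in \<open>N\<close> variables with \<open>s\<close> adjoined.
\<close>

inductive_set weyl_alg :: "nat set \<Rightarrow> weyl set" for X :: "nat set" where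
  const: "wconst c \<in> weyl_alg X"
| var: "i \<in> X \<Longrightarrow> wvar i \<in> weyl_alg X"
| deriv: "i \<in> X \<Longrightarrow> wderiv i \<in> weyl_alg X"
| S: "wS \<in> weyl_alg X"
| add: "P \<in> weyl_alg X \<Longrightarrow> Q \<in> weyl_alg X \<Longrightarrow> P + Q \<in> weyl_alg X"
| mult: "P \<in> weyl_alg X \<Longrightarrow> Q \<in> weyl_alg X \<Longrightarrow> P * Q \<in> weyl_alg X"

lemma weyl_relations:
  "wvar i * wvar j = wvar j * wvar i"
  "wderiv i * wderiv j = wderiv j * wderiv i"
  "wderiv i * wvar j - wvar j * wderiv i = (if i = j then 1 else 0)"
  "wS * P = P * wS"
  "wconst c * P = P * wconst c"
proof -
  show "wvar i * wvar j = wvar j * wvar i" by transfer (rule weyl_eq.Z_Z)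
  show "wderiv i * wderiv j = wderiv j * wderiv i" by transfer (rule weyl_eq.D_D)
  have "wderiv i * wvar j = wvar j * wderiv i + wconst (if i = j then 1 else 0)"
    by transfer (rule weyl_eq.D_Z)
  moreover have "wconst 0 = 0" "wconst 1 = 1" by (transfer, rule weyl_eq.refl)+
  ultimately show "wderiv i * wvar j - wvar j * wderiv i = (if i = j then 1 else 0)" by simp
  show "wS * P = P * wS" by transfer (rule weyl_eq.S_central)
  show "wconst c * P = P * wconst c" by transfer (rule weyl_eq.const_central)
qed

lemma weyl_act_simps:
  "weyl_act h (wconst c) u = smult (to_fract (mconst c)) u"
  "weyl_act h (wvar i) u = smult (to_fract (mvar i)) u"
  "weyl_act h (wderiv i) u = hs_deriv h i u"
  "weyl_act h wS u = [:0, 1:] * u"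
  by (simp_all add: wconst_def wvar_def wderiv_def wS_def weyl_act.abs_eq)

text \<open>The action makes the module a left \<open>A(\<complex>)[s]\<close>-module.\<close>

lemma weyl_act_add_left: "weyl_act h (P + Q) u = weyl_act h P u + weyl_act h Q u"
  by transfer simp

lemma weyl_act_mult: "weyl_act h (P * Q) u = weyl_act h P (weyl_act h Q u)"
  by transfer simp

lemma weyl_act_1 [simp]: "weyl_act h 1 u = u"
  by transfer simp

lemma weyl_act_add_right: "weyl_act h P (u + v) = weyl_act h P u + weyl_act h P v"
  by transfer (rule act_expr_add)

lemma weyl_act_const:
  "weyl_act h P (smult (to_fract (mconst c)) u) = smult (to_fract (mconst c)) (weyl_act h P u)"
  by transfer (rule act_expr_const)

lemma to_fract_power: "to_fract (a ^ k) = to_fract a ^ k"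
  by (induction k) simp_all

lemma localization_add:
  assumes "h \<in> polys X" "h \<noteq> 0" "x \<in> localization X h" "y \<in> localization X h"
  shows "x + y \<in> localization X h"
proof -
  obtain a k b l where a: "a \<in> polys X" "b \<in> polys X"
    and x: "x = to_fract a / to_fract h ^ k" "y = to_fract b / to_fract h ^ l"
    using assms(3,4) by (auto simp: localization_def)
  have "x + y = to_fract (a * h ^ l + b * h ^ k) / to_fract h ^ (k + l)"
    using assms(2) by (simp add: x to_fract_power power_add field_simps)
  moreover have "a * h ^ l + b * h ^ k \<in> polys X"
    using assms(1) a by (intro polys_add polys_mult polys_power)
  ultimately show ?thesis unfolding localization_def by blast
qed

lemma localization_mult:
  assumes "x \<in> localization X h" "y \<in> localization X h"
  shows "x * y \<in> localization X h"
proof -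
  obtain a k b l where a: "a \<in> polys X" "b \<in> polys X"
    and x: "x = to_fract a / to_fract h ^ k" "y = to_fract b / to_fract h ^ l"
    using assms by (auto simp: localization_def)
  have "x * y = to_fract (a * b) / to_fract h ^ (k + l)"
    by (simp add: x power_add)
  with a polys_mult show ?thesis unfolding localization_def by blast
qed

lemma localization_to_fract: "a \<in> polys X \<Longrightarrow> to_fract a \<in> localization X h"
  unfolding localization_def by (intro CollectI exI[of _ a] exI[of _ 0]) simp

lemma localization_divide: "a \<in> polys X \<Longrightarrow> to_fract a / to_fract h \<in> localization X h"
  unfolding localization_def by (intro CollectI exI[of _ a] exI[of _ 1]) simp

lemma localization_fract_pderiv:
  assumes "h \<in> polys X" "h \<noteq> 0" "x \<in> localization X h"
  shows "fract_pderiv i x \<in> localization X h"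
proof -
  obtain a k where a: "a \<in> polys X" and x: "x = to_fract a / to_fract h ^ k"
    using assms(3) by (auto simp: localization_def)
  have eq: "x = Fract a (h ^ k)" by (simp add: x Fract_conv_to_fract to_fract_power)
  have "fract_pderiv i x =
      to_fract (mpderiv i a * h ^ k - a * mpderiv i (h ^ k)) / to_fract h ^ (k + k)"
    using assms(2) unfolding eq
    by (subst fract_pderiv_Fract) (simp_all add: Fract_conv_to_fract to_fract_power power_add)
  moreover have "mpderiv i a * h ^ k - a * mpderiv i (h ^ k) \<in> polys X"
    using assms(1) a by (intro polys_diff polys_mult polys_power polys_mpderiv)
  ultimately show ?thesis unfolding localization_def by blast
qed

lemma hs_module_act:
  assumes "h \<in> polys X" "h \<noteq> 0" "P \<in> weyl_alg X" "u \<in> hs_module X h"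
  shows "weyl_act h P u \<in> hs_module X h"
  using assms(3,4)
proof (induction arbitrary: u)
  case (const c)
  then show ?case
    by (auto simp: hs_module_def weyl_act_simps intro!: localization_mult localization_to_fract)
next
  case (var i)
  then show ?case
    by (auto simp: hs_module_def weyl_act_simps polys_mvar
        intro!: localization_mult localization_to_fract)
next
  case (deriv i)
  then show ?case using assms(1,2)
    by (auto simp: hs_module_def weyl_act_simps coeff_hs_deriv
        simp del: times_divide_eq_right times_divide_eq_left
        intro!: localization_add localization_mult localization_divide
          localization_fract_pderiv polys_mpderiv)
next
  case S
  have "0 \<in> localization X h" using localization_to_fract[of "mconst 0" X h] polys_mconst[of 0 X]
    by simp
  with S show ?case
    by (auto simp: hs_module_def weyl_act_simps coeff_pCons split: nat.split)
next
  case (add P Q)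
  then show ?case using assms(1,2)
    by (auto simp: hs_module_def weyl_act_add_left intro!: localization_add)
next
  case (mult P Q)
  then show ?case by (simp add: weyl_act_mult)
qed


section \<open>The Bernstein-Sato polynomial\<close>

definition embed_s :: "complex poly \<Rightarrow> mpoly fract poly" where
  "embed_s b = map_poly (\<lambda>c. to_fract (mconst c)) b"

text \<open>\<open>b(s) \<cdot> h\<^sup>s = P \<cdot> h\<^bsup>s+1\<^esup>\<close> for some \<open>P\<close>, where \<open>h\<^bsup>s+1\<^esup> = h \<cdot> h\<^sup>s\<close>.\<close>

definition bernstein_eq :: "nat set \<Rightarrow> mpoly \<Rightarrow> complex poly \<Rightarrow> bool" where
  "bernstein_eq X h b \<longleftrightarrow> (\<exists>P \<in> weyl_alg X. embed_s b = weyl_act h P [:to_fract h:])"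

definition is_bernstein_sato :: "nat set \<Rightarrow> mpoly \<Rightarrow> complex poly \<Rightarrow> bool" where
  "is_bernstein_sato X h b \<longleftrightarrow> b \<noteq> 0 \<and> lead_coeff b = 1 \<and> bernstein_eq X h b \<and>
     (\<forall>c. c \<noteq> 0 \<and> bernstein_eq X h c \<longrightarrow> degree b \<le> degree c)"

text \<open>
  The polynomial is unique if it exists (lemma \<open>bernstein_sato_unique\<close>). It exists, by
  Bernstein's theorem, whenever \<open>X\<close> is finite and \<open>h\<close> is a non-zero element of
  \<open>polys X\<close>; the value \<open>0\<close> in the other case only makes the function total.
\<close>

definition bernstein_sato :: "nat set \<Rightarrow> mpoly \<Rightarrow> complex poly" where
  "bernstein_sato X h = (if \<exists>b. is_bernstein_sato X h b
     then THE b. is_bernstein_sato X h b else 0)"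

lemma embed_s_in_hs_module: "embed_s b \<in> hs_module X h"
  by (simp add: hs_module_def embed_s_def coeff_map_poly localization_to_fract)

lemma bernstein_eq_diff:
  assumes "bernstein_eq X h b" "bernstein_eq X h c"
  shows "bernstein_eq X h (b - c)"
proof -
  obtain P Q where P: "P \<in> weyl_alg X" "embed_s b = weyl_act h P [:to_fract h:]"
    and Q: "Q \<in> weyl_alg X" "embed_s c = weyl_act h Q [:to_fract h:]"
    using assms by (auto simp: bernstein_eq_def)
  have "embed_s (b - c) = weyl_act h (P + wconst (- 1) * Q) [:to_fract h:]"
    by (simp add: weyl_act_add_left weyl_act_mult weyl_act_simps flip: P(2) Q(2))
      (rule poly_eqI, simp add: embed_s_def coeff_map_poly mconst_uminus mconst_diff)
  moreover have "P + wconst (- 1) * Q \<in> weyl_alg X"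
    using P(1) Q(1) by (intro weyl_alg.intros)
  ultimately show ?thesis by (auto simp: bernstein_eq_def)
qed

lemma bernstein_sato_unique:
  assumes "is_bernstein_sato X h b" "is_bernstein_sato X h c"
  shows "b = c"
proof (rule ccontr)
  assume "b \<noteq> c"
  have deg: "degree b = degree c"
    using assms by (auto simp: is_bernstein_sato_def intro: antisym)
  have "bernstein_eq X h (b - c)"
    using assms by (intro bernstein_eq_diff) (auto simp: is_bernstein_sato_def)
  with assms \<open>b \<noteq> c\<close> have le: "degree b \<le> degree (b - c)"
    by (auto simp: is_bernstein_sato_def)
  have "degree (b - c) \<le> degree b"
    using deg by (simp add: degree_diff_le)
  with le have "degree (b - c) = degree b" by simp
  moreover have "coeff (b - c) (degree b) = 0"
    using assms deg by (simp add: is_bernstein_sato_def)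
  ultimately have "lead_coeff (b - c) = 0" by (simp only:)
  with \<open>b \<noteq> c\<close> show False by (simp only: leading_coeff_0_iff right_minus_eq)
qed

lemma bernstein_sato_eqI: "is_bernstein_sato X h b \<Longrightarrow> bernstein_sato X h = b"
  unfolding bernstein_sato_def by (auto intro: bernstein_sato_unique)

end

theory Submission
  imports Defs "HOL-Computational_Algebra.Field_as_Ring"
begin

text \<open>
  Write \<open>N(h)\<close> for the submodule \<open>A[s] \<cdot> h\<^bsup>s+1\<^esup>\<close>. The polynomials \<open>b\<close> with
  \<open>b \<cdot> h\<^sup>s \<in> N(h)\<close> form an ideal of \<open>\<complex>[s]\<close>, generated by the Bernstein-Sato polynomial when
  the ideal is non-zero. By the Leibniz rule, and because the variables of \<open>f\<close> and \<open>g\<close> are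
  disjoint, an operator in the variables of \<open>f\<close> acts on \<open>u f\<^sup>s \<cdot> v g\<^sup>s\<close>, where \<open>v\<close> depends on the
  variables of \<open>g\<close> only, through its action on \<open>u f\<^sup>s\<close>. So \<open>b\<^sub>f b\<^sub>g\<close> satisfies a functional equation for \<open>f g\<close> (\<open>bernstein_eq_product\<close>), and
  every element of \<open>N(f g)\<close> is a finite sum of products of elements of \<open>N(f)\<close> and \<open>N(g)\<close>
  (\<open>hs1_module_product\<close>).

  It remains to see that \<open>b\<^sub>f b\<^sub>g\<close> divides every \<open>c\<close> with \<open>c \<cdot> f\<^sup>s g\<^sup>s \<in> N(f g)\<close>. If not, then
  cancelling \<open>gcd (b\<^sub>f b\<^sub>g) c\<close> gives a prime \<open>t\<close> of \<open>\<complex>[s]\<close> and a polynomial \<open>d\<close> prime to \<open>t\<close>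
  such that \<open>d \<cdot> (b\<^sub>f f\<^sup>s) (b\<^sub>g g\<^sup>s)\<close> lies in \<open>t \<cdot> N(f) N(g)\<close>. If \<open>N(f)\<close> and \<open>N(g)\<close> were free
  over \<open>\<complex>[s]\<close>, then reduction modulo \<open>t\<close> would turn this into the vanishing of a tensor
  \<open>u \<otimes> v\<close> over the field \<open>\<complex>[s]/t\<close>, so that \<open>b\<^sub>f f\<^sup>s \<in> t N(f)\<close> or \<open>b\<^sub>g g\<^sup>s \<in> t N(g)\<close>; and
  dividing by \<open>t\<close> would contradict the minimality of \<open>b\<^sub>f\<close> or of \<open>b\<^sub>g\<close>. Only finitely many
  elements of the two modules occur, and for them the torsion-freeness of the modules suffices:
  \<open>prime_tensor_cancel\<close> reaches the same alternative by elimination, up to a factor prime to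
  \<open>t\<close> that does no harm (\<open>bernstein_sato_not_in_multiple\<close>). The coordinates to which it is
  applied are the coefficients at the monomials, and they are multiplicative for products of
  polynomials in disjoint sets of variables (\<open>hs_module_tensor_coordinates\<close>).

  The same coordinates show that a functional equation for \<open>f g\<close> yields one for \<open>f\<close>
  (\<open>bernstein_eq_product_factor\<close>): fix one coordinate of the second factor. Hence the
  Bernstein-Sato polynomial exists for \<open>f g\<close> exactly if it exists for both \<open>f\<close> and \<open>g\<close>, and under the convention that it is
  \<open>0\<close> otherwise both sides of the identity vanish together.
\<close>


section \<open>Linear algebra over a factorial ring\<close>

text \<open>
  The power of \<open>t\<close> of least order among the entries of a non-zero row divides all of them, and
  after this division some entry, the pivot, is prime to \<open>t\<close>.
\<close>
lemma row_pivot: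
  fixes t :: "'r :: factorial_ring_gcd" and x :: "'i \<Rightarrow> 'r"
  assumes "finite J" and "j0 \<in> J" and "x j0 \<noteq> 0" and "prime_elem t"
  obtains w y j where "w \<noteq> 0" and "\<And>i. i \<in> J \<Longrightarrow> x i = w * y i"
    and "j \<in> J" and "\<not> t dvd y j"
proof -
  let ?e = "\<lambda>i. multiplicity t (x i)"
  define K where "K = {i \<in> J. x i \<noteq> 0}"
  have "finite K" "K \<noteq> {}" using assms(1-3) by (auto simp: K_def)
  then obtain j where j: "j \<in> K" "\<And>i. i \<in> K \<Longrightarrow> ?e j \<le> ?e i"
    using ex_min_if_finite[of "?e ` K"] by (metis arg_min_least arg_min_if_finite(1))
  have "t ^ ?e j dvd x i" if "i \<in> J" for i
    using j that by (cases "x i = 0") (auto simp: K_def intro: multiplicity_dvd')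
  then obtain y where y: "\<And>i. i \<in> J \<Longrightarrow> x i = t ^ ?e j * y i"
    unfolding dvd_def by metis
  show thesis
  proof (rule that)
    show "t ^ ?e j \<noteq> 0" using assms(4) by auto
    show "\<And>i. i \<in> J \<Longrightarrow> x i = t ^ ?e j * y i" by (rule y)
    show "j \<in> J" using j by (simp add: K_def)
    show "\<not> t dvd y j"
    proof
      have y_j: "t ^ ?e j * y j = x j" using y[of j] j by (simp add: K_def)
      assume "t dvd y j"
      then have "t ^ ?e j * t dvd t ^ ?e j * y j"
        by (intro mult_dvd_mono dvd_refl)
      then have "t ^ Suc (?e j) dvd t ^ ?e j * y j"
        by (simp only: power_Suc2)
      then have "t ^ Suc (?e j) dvd x j" by (simp only: y_j)
      moreover have "x j \<noteq> 0" "\<not> is_unit t" using j assms(4) by (auto simp: K_def)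
      ultimately show False
        using power_dvd_iff_le_multiplicity by (metis not_less_eq_eq order_refl)
    qed
  qed
qed

text \<open>
  Let \<open>R\<close> be the ring and \<open>R\<^sub>t\<close> its localisation at the prime \<open>t\<close>. The hypothesis says that a
  unit of \<open>R\<^sub>t\<close> times \<open>a0 \<otimes> b0\<close> equals \<open>t\<close> times a tensor in the spans of the \<open>a i\<close> and of the
  \<open>b i\<close>; the conclusion says that \<open>a0\<close> or \<open>b0\<close> is itself in \<open>t\<close> times the corresponding span
  over \<open>R\<^sub>t\<close>. Choose a coordinate \<open>m0\<close> at which \<open>a0\<close> does not vanish, with the pivot of
  \<open>row_pivot\<close> in that row. If \<open>a0\<close> has the pivot, the relation at \<open>m0\<close> solves for \<open>b0\<close>. If the
  pivot is at \<open>i0 \<in> I\<close> and \<open>t\<close> divides the entry of \<open>a0\<close>, one elimination step removes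
  \<open>a i0\<close> and keeps the shape of the relation; a conclusion about the modified \<open>a0\<close> carries over
  because the step scales \<open>a0\<close> by the pivot, a unit of \<open>R\<^sub>t\<close>, and subtracts from it a multiple
  of \<open>t\<close> times \<open>a i0\<close>.
\<close>
lemma prime_tensor_cancel:
  fixes t :: "'r :: factorial_ring_gcd"
    and a0 :: "'m \<Rightarrow> 'r" and b0 :: "'n \<Rightarrow> 'r" and a :: "'i \<Rightarrow> 'm \<Rightarrow> 'r" and b :: "'i \<Rightarrow> 'n \<Rightarrow> 'r"
  assumes "finite I" and t: "prime_elem t" and "\<not> t dvd d"
    and "\<And>m n. m \<in> M \<Longrightarrow> n \<in> N \<Longrightarrow> d * a0 m * b0 n = t * (\<Sum>i\<in>I. a i m * b i n)"
  shows "(\<exists>e c. \<not> t dvd e \<and> (\<forall>m\<in>M. e * a0 m = t * (\<Sum>i\<in>I. c i * a i m))) \<or>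
    (\<exists>e c. \<not> t dvd e \<and> (\<forall>n\<in>N. e * b0 n = t * (\<Sum>i\<in>I. c i * b i n)))"
  using assms(1,3,4)
proof (induction "card I" arbitrary: I d a0 a)
  case (0 I d a0 a)
  then have "I = {}" by simp
  with 0 have "d * a0 m * b0 n = 0" if "m \<in> M" "n \<in> N" for m n using that by simp
  moreover have "d \<noteq> 0" using 0 by auto
  ultimately have "(\<forall>m\<in>M. a0 m = 0) \<or> (\<forall>n\<in>N. b0 n = 0)" by auto
  moreover have "\<not> t dvd 1" using t by auto
  ultimately show ?case using \<open>I = {}\<close> by (metis mult_zero_right sum.empty)
next
  case (Suc k I d a0 a)
  show ?case
  proof (cases "\<forall>m\<in>M. a0 m = 0")
    case True
    then have "\<forall>m\<in>M. 1 * a0 m = t * (\<Sum>i\<in>I. 0 * a i m)" by simp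
    moreover have "\<not> t dvd 1" using t by auto
    ultimately show ?thesis by (intro disjI1 exI[of _ 1] exI[of _ "\<lambda>_. 0"]) simp
  next
    case False
    then obtain m0 where m0: "m0 \<in> M" "a0 m0 \<noteq> 0" by blast
    \<comment> \<open>The row at \<open>m0\<close>, with the entry of \<open>a0\<close> at index \<open>None\<close>.\<close>
    define x where "x = case_option (a0 m0) (\<lambda>i. a i m0)"
    obtain w y j where w: "w \<noteq> 0" and y: "\<And>i. i \<in> insert None (Some ` I) \<Longrightarrow> x i = w * y i"
      and j: "j \<in> insert None (Some ` I)" "\<not> t dvd y j"
      using row_pivot[of "insert None (Some ` I)" None x t] Suc.prems(1) m0 t
      by (auto simp: x_def)
    define r0 where "r0 = y None"
    define r where "r i = y (Some i)" for i
    have a0: "a0 m0 = w * r0" using y[of None] by (simp add: x_def r0_def)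
    have a: "a i m0 = w * r i" if "i \<in> I" for i
      using y[of "Some i"] that by (simp add: x_def r_def)
    have row: "d * r0 * b0 n = t * (\<Sum>i\<in>I. r i * b i n)" if n: "n \<in> N" for n
    proof -
      have "w * (d * r0 * b0 n) = d * a0 m0 * b0 n" by (simp add: a0)
      also have "\<dots> = t * (\<Sum>i\<in>I. a i m0 * b i n)" by (rule Suc.prems(3)[OF m0(1) n])
      also have "\<dots> = w * (t * (\<Sum>i\<in>I. r i * b i n))"
        by (simp add: a sum_distrib_left mult_ac)
      finally show ?thesis using w by simp
    qed
    show ?thesis
    proof (cases "t dvd r0")
      case False
      then have "\<not> t dvd d * r0" using t Suc.prems(2) by (simp add: prime_elem_dvd_mult_iff)
      with row show ?thesis
        by (intro disjI2 exI[of _ "d * r0"] exI[of _ r] conjI ballI)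
    next
      case True
      then obtain q where q: "r0 = t * q" by (auto elim: dvdE)
      from True j obtain i0 where i0: "i0 \<in> I" "\<not> t dvd r i0"
        by (auto simp: r0_def r_def)
      define I' where "I' = I - {i0}"
      have I': "I = insert i0 I'" "finite I'" "i0 \<notin> I'" "k = card I'"
        using i0 Suc.prems(1) Suc.hyps(2) by (auto simp: I'_def)
      define a0' where "a0' m = r i0 * a0 m - r0 * a i0 m" for m
      define a' where "a' i m = r i0 * a i m - r i * a i0 m" for i m
      have eq: "d * a0' m * b0 n = t * (\<Sum>i\<in>I'. a' i m * b i n)" if mn: "m \<in> M" "n \<in> N" for m n
      proof -
        have "d * a0' m * b0 n = r i0 * (d * a0 m * b0 n) - a i0 m * (d * r0 * b0 n)"
          by (simp add: a0'_def algebra_simps)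
        also have "\<dots> = t * (r i0 * (\<Sum>i\<in>I. a i m * b i n) - a i0 m * (\<Sum>i\<in>I. r i * b i n))"
          unfolding Suc.prems(3)[OF mn] row[OF mn(2)] by (simp add: algebra_simps)
        also have "r i0 * (\<Sum>i\<in>I. a i m * b i n) - a i0 m * (\<Sum>i\<in>I. r i * b i n)
            = (\<Sum>i\<in>I'. a' i m * b i n)"
          unfolding I'(1) sum.insert[OF I'(2,3)]
          by (simp add: a'_def algebra_simps sum_distrib_left sum_subtractf)
        finally show ?thesis .
      qed
      from Suc.hyps(1)[OF I'(4,2) Suc.prems(2), of a0' a'] eq consider
        e c where "\<not> t dvd e" "\<And>m. m \<in> M \<Longrightarrow> e * a0' m = t * (\<Sum>i\<in>I'. c i * a' i m)"
        | e c where "\<not> t dvd e" "\<And>n. n \<in> N \<Longrightarrow> e * b0 n = t * (\<Sum>i\<in>I'. c i * b i n)"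
        by blast
      then show ?thesis
      proof cases
        case (1 e c)
        \<comment> \<open>Expanding \<open>a0'\<close> and \<open>a'\<close>, with \<open>r0 = t * q\<close>, and collecting the multiples of \<open>a i0\<close>.\<close>
        define c' where "c' i = (if i = i0 then e * q - (\<Sum>i\<in>I'. c i * r i) else c i * r i0)" for i
        have "e * r i0 * a0 m = t * (\<Sum>i\<in>I. c' i * a i m)" if m: "m \<in> M" for m
        proof -
          have "(\<Sum>i\<in>I'. c' i * a i m) = (\<Sum>i\<in>I'. c i * r i0 * a i m)"
            using I'(3) by (intro sum.cong) (auto simp: c'_def)
          then have c': "(\<Sum>i\<in>I. c' i * a i m) = (e * q - (\<Sum>i\<in>I'. c i * r i)) * a i0 m
              + (\<Sum>i\<in>I'. c i * r i0 * a i m)"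
            unfolding I'(1) sum.insert[OF I'(2,3)] by (simp add: c'_def)
          have "e * r i0 * a0 m = e * a0' m + t * (e * q * a i0 m)"
            by (simp add: a0'_def q algebra_simps)
          also have "\<dots> = t * (\<Sum>i\<in>I. c' i * a i m)"
            unfolding 1(2)[OF m] c'
            by (simp add: a'_def algebra_simps sum_distrib_left sum_distrib_right sum_subtractf)
          finally show ?thesis .
        qed
        moreover have "\<not> t dvd e * r i0" using t 1 i0 by (simp add: prime_elem_dvd_mult_iff)
        ultimately show ?thesis
          by (intro disjI1 exI[of _ "e * r i0"] exI[of _ c'] conjI ballI)
      next
        case (2 e c)
        have "(\<Sum>i\<in>I. (if i = i0 then 0 else c i) * b i n) = (\<Sum>i\<in>I'. c i * b i n)" for n
          unfolding I'(1) sum.insert[OF I'(2,3)] using I'(3)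
          by (auto intro!: sum.cong)
        with 2(2) have "\<forall>n\<in>N. e * b0 n = t * (\<Sum>i\<in>I. (if i = i0 then 0 else c i) * b i n)"
          by simp
        with 2(1) show ?thesis
          by (intro disjI2 exI[of _ e] exI[of _ "\<lambda>i. if i = i0 then 0 else c i"] conjI)
      qed
    qed
  qed
qed


section \<open>Coefficients of monomials\<close>

lemma polys_induct [consumes 1, case_names single add]:
  assumes p: "p \<in> polys X"
    and single: "\<And>m c. Poly_Mapping.keys m \<subseteq> X \<Longrightarrow> P (Poly_Mapping.single m c)"
    and add: "\<And>p q. P p \<Longrightarrow> P q \<Longrightarrow> P (p + q)"
  shows "P p"
proof -
  have eq: "p = (\<Sum>m \<in> Poly_Mapping.keys p. Poly_Mapping.single m (Poly_Mapping.lookup p m))"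
    by (rule poly_mapping_eqI)
      (auto simp: lookup_sum lookup_single when_def in_keys_iff sum.delta)
  have "P (\<Sum>m \<in> A. Poly_Mapping.single m (Poly_Mapping.lookup p m))"
    if "finite A" "\<And>m. m \<in> A \<Longrightarrow> Poly_Mapping.keys m \<subseteq> X" for A
    using that
  proof (induction A rule: finite_induct)
    case empty
    show ?case using single[of 0 0] by simp
  next
    case (insert x F)
    then show ?case by (simp add: single add)
  qed
  from this[OF finite_keys, of p] p show ?thesis by (subst eq) (auto simp: polys_def)
qed

lemma disjoint_monomials_add_eq:
  fixes m m' n n' :: "nat \<Rightarrow>\<^sub>0 nat"
  assumes "X \<inter> Y = {}" and "Poly_Mapping.keys m \<subseteq> X" "Poly_Mapping.keys m' \<subseteq> X"
    and "Poly_Mapping.keys n \<subseteq> Y" "Poly_Mapping.keys n' \<subseteq> Y" and eq: "m + n = m' + n'"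
  shows "m = m' \<and> n = n'"
proof -
  have lk: "Poly_Mapping.lookup m i + Poly_Mapping.lookup n i
      = Poly_Mapping.lookup m' i + Poly_Mapping.lookup n' i" for i
    using arg_cong[OF eq, of "\<lambda>m. Poly_Mapping.lookup m i"] by (simp add: lookup_add)
  have "Poly_Mapping.lookup m i = Poly_Mapping.lookup m' i" for i
  proof (cases "i \<in> X")
    case True
    then have "i \<notin> Poly_Mapping.keys n" "i \<notin> Poly_Mapping.keys n'" using assms(1-5) by blast+
    with lk[of i] show ?thesis by (simp add: in_keys_iff)
  next
    case False
    then have "i \<notin> Poly_Mapping.keys m" "i \<notin> Poly_Mapping.keys m'" using assms(1-5) by blast+
    then show ?thesis by (simp add: in_keys_iff)
  qed
  then have "m = m'" by (rule poly_mapping_eqI)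
  with eq show ?thesis by simp
qed

text \<open>
  The coefficient form of linear disjointness: a monomial in \<open>X \<union> Y\<close> splits in only one way, so
  the product \<open>p q\<close> is the tensor \<open>p \<otimes> q\<close> on coefficients.
\<close>
lemma lookup_mult_disjoint:
  fixes p q :: mpoly
  assumes XY: "X \<inter> Y = {}" and p: "p \<in> polys X" and q: "q \<in> polys Y"
    and m: "Poly_Mapping.keys m \<subseteq> X" and n: "Poly_Mapping.keys n \<subseteq> Y"
  shows "Poly_Mapping.lookup (p * q) (m + n) = Poly_Mapping.lookup p m * Poly_Mapping.lookup q n"
  using p
proof (induction rule: polys_induct)
  case (single m' c)
  show ?case using q
  proof (induction rule: polys_induct)
    case (single n' d)
    have "m' + n' = m + n \<longleftrightarrow> m' = m \<and> n' = n"
      using disjoint_monomials_add_eq[OF XY] m n single \<open>Poly_Mapping.keys m' \<subseteq> X\<close> by metis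
    then show ?case by (auto simp: mult_single lookup_single when_def)
  next
    case (add p q)
    then show ?case by (simp add: lookup_add algebra_simps)
  qed
next
  case (add p q)
  then show ?case by (simp add: lookup_add algebra_simps)
qed

lemma lookup_mconst_mult:
  "Poly_Mapping.lookup (mconst c * p) m = c * Poly_Mapping.lookup p m"
  by (induction p rule: mpoly_induct)
    (auto simp: mconst_def mult_single lookup_single lookup_add when_def algebra_simps)

definition polys_s :: "nat set \<Rightarrow> mpoly poly set" where
  "polys_s X = {p. \<forall>k. coeff p k \<in> polys X}"

text \<open>
  An element of \<open>\<complex>[z][s]\<close> read as a polynomial in \<open>z\<close> with coefficients in \<open>\<complex>[s]\<close>: these
  coefficients are the \<open>\<complex>[s]\<close>-linear coordinates.
\<close>
definition coeff_s :: "(nat \<Rightarrow>\<^sub>0 nat) \<Rightarrow> mpoly poly \<Rightarrow> complex poly" where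
  "coeff_s m p = map_poly (\<lambda>q. Poly_Mapping.lookup q m) p"

lemma coeff_coeff_s: "coeff (coeff_s m p) k = Poly_Mapping.lookup (coeff p k) m"
  by (simp add: coeff_s_def coeff_map_poly)

lemma coeff_s_0 [simp]: "coeff_s m 0 = 0"
  by (rule poly_eqI) (simp add: coeff_coeff_s)

lemma coeff_s_add: "coeff_s m (p + q) = coeff_s m p + coeff_s m q"
  by (rule poly_eqI) (simp add: coeff_coeff_s lookup_add)

lemma coeff_s_sum: "coeff_s m (\<Sum>i\<in>I. p i) = (\<Sum>i\<in>I. coeff_s m (p i))"
  by (induction I rule: infinite_finite_induct) (simp_all add: coeff_s_add)

lemma coeff_s_const_mult: "coeff_s m (map_poly mconst c * p) = c * coeff_s m p"
proof (induction c)
  case 0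
  show ?case by simp
next
  case (pCons a c)
  have "coeff_s m (smult (mconst a) p) = smult a (coeff_s m p)"
    by (rule poly_eqI) (simp add: coeff_coeff_s lookup_mconst_mult)
  moreover have "coeff_s m (pCons 0 p) = pCons 0 (coeff_s m p)" for p
    by (rule poly_eqI) (simp add: coeff_coeff_s coeff_pCons split: nat.split)
  ultimately show ?case
    using pCons by (simp add: map_poly_pCons coeff_s_add)
qed

lemma coeff_s_mult_disjoint:
  assumes "X \<inter> Y = {}" and "p \<in> polys_s X" and "q \<in> polys_s Y"
    and "Poly_Mapping.keys m \<subseteq> X" and "Poly_Mapping.keys n \<subseteq> Y"
  shows "coeff_s (m + n) (p * q) = coeff_s m p * coeff_s n q"
  using assms
  by (intro poly_eqI)
    (simp add: coeff_coeff_s coeff_mult lookup_sum polys_s_def lookup_mult_disjoint[of X Y])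

lemma polys_s_eqI:
  assumes "p \<in> polys_s X" and "q \<in> polys_s X"
    and "\<And>m. Poly_Mapping.keys m \<subseteq> X \<Longrightarrow> coeff_s m p = coeff_s m q"
  shows "p = q"
proof (intro poly_eqI poly_mapping_eqI)
  fix k m
  show "Poly_Mapping.lookup (coeff p k) m = Poly_Mapping.lookup (coeff q k) m"
  proof (cases "Poly_Mapping.keys m \<subseteq> X")
    case True
    from arg_cong[OF assms(3)[OF this], of "\<lambda>r. coeff r k"] show ?thesis
      by (simp add: coeff_coeff_s)
  next
    case False
    then show ?thesis using assms(1,2)
      by (metis (mono_tags, lifting) in_keys_iff mem_Collect_eq polys_def polys_s_def)
  qed
qed

lemma polys_0 [simp]: "0 \<in> polys X"
  using polys_mconst[of 0 X] by simp

lemma polys_sum: "(\<And>i. i \<in> I \<Longrightarrow> p i \<in> polys X) \<Longrightarrow> (\<Sum>i\<in>I. p i) \<in> polys X"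
  by (induction I rule: infinite_finite_induct) (simp_all add: polys_add)

lemma polys_s_mult: "p \<in> polys_s X \<Longrightarrow> q \<in> polys_s X \<Longrightarrow> p * q \<in> polys_s X"
  by (auto simp: polys_s_def coeff_mult intro!: polys_sum polys_mult)

lemma polys_s_sum: "(\<And>i. i \<in> I \<Longrightarrow> p i \<in> polys_s X) \<Longrightarrow> (\<Sum>i\<in>I. p i) \<in> polys_s X"
  by (auto simp: polys_s_def coeff_sum intro!: polys_sum)

lemma polys_s_const: "map_poly mconst c \<in> polys_s X"
  by (simp add: polys_s_def coeff_map_poly)


section \<open>Linear disjointness\<close>

text \<open>
  Stated for all large \<open>k\<close> so that finitely many elements have a common denominator.
\<close>
lemma clear_denominators:
  assumes h: "h \<in> polys X" "h \<noteq> 0" and u: "u \<in> hs_module X h"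
  shows "\<forall>\<^sub>F k in sequentially. \<exists>p \<in> polys_s X. smult (to_fract (h ^ k)) u = map_poly to_fract p"
proof -
  have "\<forall>\<^sub>F k in sequentially. \<exists>a \<in> polys X. to_fract (h ^ k) * coeff u j = to_fract a" for j
  proof -
    obtain a l where a: "a \<in> polys X" and eq: "coeff u j = to_fract a / to_fract h ^ l"
      using u unfolding hs_module_def localization_def by blast
    have "\<exists>a \<in> polys X. to_fract (h ^ k) * coeff u j = to_fract a" if "k \<ge> l" for k
    proof
      show "h ^ (k - l) * a \<in> polys X" using h a by (intro polys_mult polys_power)
      have "to_fract (h ^ k) = to_fract h ^ (k - l) * to_fract h ^ l"
        using that by (simp add: to_fract_power flip: power_add)
      then show "to_fract (h ^ k) * coeff u j = to_fract (h ^ (k - l) * a)"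
        using h by (simp add: eq to_fract_power)
    qed
    then show ?thesis by (auto simp: eventually_sequentially)
  qed
  then have "\<forall>\<^sub>F k in sequentially. \<forall>j\<in>{..degree u}.
      \<exists>a \<in> polys X. to_fract (h ^ k) * coeff u j = to_fract a"
    by (intro eventually_ball_finite) auto
  then show ?thesis
  proof (rule eventually_mono)
    fix k assume "\<forall>j\<in>{..degree u}. \<exists>a \<in> polys X. to_fract (h ^ k) * coeff u j = to_fract a"
    then obtain a where a: "\<And>j. j \<le> degree u \<Longrightarrow> a j \<in> polys X"
      "\<And>j. j \<le> degree u \<Longrightarrow> to_fract (h ^ k) * coeff u j = to_fract (a j)"
      by (metis atMost_iff)
    define p where "p = (\<Sum>j\<le>degree u. monom (a j) j)"
    have p: "coeff p j = (if j \<le> degree u then a j else 0)" for j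
      by (simp add: p_def coeff_sum)
    have "smult (to_fract (h ^ k)) u = map_poly to_fract p"
      using a(2) by (intro poly_eqI) (auto simp: coeff_map_poly p coeff_eq_0)
    moreover have "p \<in> polys_s X" using a(1) by (simp add: polys_s_def p)
    ultimately show "\<exists>p \<in> polys_s X. smult (to_fract (h ^ k)) u = map_poly to_fract p" by blast
  qed
qed

lemma clear_common_denominator:
  assumes h: "h \<in> polys X" "h \<noteq> 0" and "finite I"
    and u: "u0 \<in> hs_module X h" "\<forall>i\<in>I. u i \<in> hs_module X h"
  obtains k p0 p where "p0 \<in> polys_s X" "smult (to_fract (h ^ k)) u0 = map_poly to_fract p0"
    "\<And>i. i \<in> I \<Longrightarrow> p i \<in> polys_s X"
    "\<And>i. i \<in> I \<Longrightarrow> smult (to_fract (h ^ k)) (u i) = map_poly to_fract (p i)"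
proof -
  have "\<forall>\<^sub>F k in sequentially.
      (\<exists>p \<in> polys_s X. smult (to_fract (h ^ k)) u0 = map_poly to_fract p) \<and>
      (\<forall>i\<in>I. \<exists>p \<in> polys_s X. smult (to_fract (h ^ k)) (u i) = map_poly to_fract p)"
    using assms by (intro eventually_conj eventually_ball_finite ballI clear_denominators) auto
  then obtain k where "\<exists>p \<in> polys_s X. smult (to_fract (h ^ k)) u0 = map_poly to_fract p"
    "\<forall>i\<in>I. \<exists>p \<in> polys_s X. smult (to_fract (h ^ k)) (u i) = map_poly to_fract p"
    using eventually_happens'[OF sequentially_bot] by blast
  then show thesis using that by metis
qed

lemma fract_poly_sum:
  fixes p :: "'i \<Rightarrow> 'a :: idom poly"
  shows "map_poly to_fract (\<Sum>i\<in>I. p i) = (\<Sum>i\<in>I. map_poly to_fract (p i))"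
  by (induction I rule: infinite_finite_induct) simp_all

lemma smult_sum_right: "smult c (\<Sum>i\<in>I. p i) = (\<Sum>i\<in>I. smult c (p i))"
  by (induction I rule: infinite_finite_induct) (simp_all add: smult_add_right)

lemma embed_s_fract_poly: "embed_s c = map_poly to_fract (map_poly mconst c)"
  by (rule poly_eqI) (simp add: embed_s_def coeff_map_poly)

lemma embed_s_0 [simp]: "embed_s 0 = 0" and embed_s_1 [simp]: "embed_s 1 = 1"
  by (simp_all add: embed_s_def)

lemma embed_s_pCons: "embed_s (pCons a c) = pCons (to_fract (mconst a)) (embed_s c)"
  by (simp add: embed_s_def map_poly_pCons)

lemma embed_s_add: "embed_s (b + c) = embed_s b + embed_s c"
  by (rule poly_eqI) (simp add: embed_s_def coeff_map_poly mconst_add)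

lemma embed_s_mult: "embed_s (b * c) = embed_s b * embed_s c"
proof (induction b)
  case (pCons a b)
  have "embed_s (smult a c) = smult (to_fract (mconst a)) (embed_s c)"
    by (rule poly_eqI) (simp add: embed_s_def coeff_map_poly mconst_mult)
  with pCons show ?case by (simp add: embed_s_pCons embed_s_add)
qed simp

lemma degree_embed_s: "degree (embed_s c) = degree c"
  unfolding embed_s_def by (rule degree_map_poly) simp

lemma embed_s_eq_0_iff [simp]: "embed_s c = 0 \<longleftrightarrow> c = 0"
  unfolding embed_s_def by (rule map_poly_eq_0_iff) auto

text \<open>
  A \<open>\<complex>[s]\<close>-linear relation can be checked on coordinates after clearing denominators, since
  multiplication by \<open>h ^ k\<close> is injective.
\<close>
lemma polys_s_relation:
  assumes h: "h \<noteq> 0" and r: "r0 \<in> polys_s X" "smult (to_fract (h ^ k)) u0 = map_poly to_fract r0"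
    "\<And>i. i \<in> I \<Longrightarrow> r i \<in> polys_s X"
    "\<And>i. i \<in> I \<Longrightarrow> smult (to_fract (h ^ k)) (u i) = map_poly to_fract (r i)"
    and c: "\<And>m. Poly_Mapping.keys m \<subseteq> X \<Longrightarrow> e * coeff_s m r0 = t * (\<Sum>i\<in>I. c i * coeff_s m (r i))"
  shows "embed_s e * u0 = embed_s t * (\<Sum>i\<in>I. embed_s (c i) * u i)"
proof -
  have R: "map_poly mconst e * r0 = map_poly mconst t * (\<Sum>i\<in>I. map_poly mconst (c i) * r i)"
    using r(1,3) c
    by (intro polys_s_eqI[of _ X] polys_s_mult polys_s_sum polys_s_const)
      (simp_all add: coeff_s_const_mult coeff_s_sum)
  have "smult (to_fract (h ^ k)) (embed_s e * u0) = map_poly to_fract (map_poly mconst e * r0)"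
    by (simp add: embed_s_fract_poly flip: r(2))
  also have "\<dots> = embed_s t * (\<Sum>i\<in>I. embed_s (c i) * map_poly to_fract (r i))"
    by (simp add: R embed_s_fract_poly fract_poly_sum)
  also have "\<dots> = smult (to_fract (h ^ k)) (embed_s t * (\<Sum>i\<in>I. embed_s (c i) * u i))"
    by (simp add: sum_distrib_left smult_sum_right flip: r(4))
  finally show ?thesis by (rule smult_cancel[rotated]) (use h in simp)
qed

text \<open>
  Linear disjointness in the form in which it is used: there are coordinates \<open>a0\<close>, \<open>a i\<close> of
  \<open>u0\<close>, \<open>u i\<close> and \<open>b0\<close>, \<open>b i\<close> of \<open>v0\<close>, \<open>v i\<close> with values in \<open>\<complex>[s]\<close>, faithful for linear
  relations within each family, for which the relation between products becomes one between
  tensors. The coordinates depend on the families through the powers of \<open>f\<close> and \<open>g\<close> that clear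
  the denominators.
\<close>
lemma hs_module_tensor_coordinates:
  assumes XY: "X \<inter> Y = {}" and f: "f \<in> polys X" "f \<noteq> 0" and g: "g \<in> polys Y" "g \<noteq> 0"
    and I: "finite I"
    and u: "u0 \<in> hs_module X f" "\<forall>i\<in>I. u i \<in> hs_module X f"
    and v: "v0 \<in> hs_module Y g" "\<forall>i\<in>I. v i \<in> hs_module Y g"
    and eq: "embed_s d * (u0 * v0) = embed_s t * (\<Sum>i\<in>I. u i * v i)"
  shows "\<exists>(M :: (nat \<Rightarrow>\<^sub>0 nat) set) (N :: (nat \<Rightarrow>\<^sub>0 nat) set) a0 b0 a b.
    (\<forall>m\<in>M. \<forall>n\<in>N. d * a0 m * b0 n = t * (\<Sum>i\<in>I. a i m * b i n)) \<and>
    (\<forall>e t c. (\<forall>m\<in>M. e * a0 m = t * (\<Sum>i\<in>I. c i * a i m)) \<longrightarrow>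
      embed_s e * u0 = embed_s t * (\<Sum>i\<in>I. embed_s (c i) * u i)) \<and>
    (\<forall>e t c. (\<forall>n\<in>N. e * b0 n = t * (\<Sum>i\<in>I. c i * b i n)) \<longrightarrow>
      embed_s e * v0 = embed_s t * (\<Sum>i\<in>I. embed_s (c i) * v i))"
proof -
  obtain k p0 p where p: "p0 \<in> polys_s X" "smult (to_fract (f ^ k)) u0 = map_poly to_fract p0"
    "\<And>i. i \<in> I \<Longrightarrow> p i \<in> polys_s X"
    "\<And>i. i \<in> I \<Longrightarrow> smult (to_fract (f ^ k)) (u i) = map_poly to_fract (p i)"
    using clear_common_denominator[OF f I u] by metis
  obtain l q0 q where q: "q0 \<in> polys_s Y" "smult (to_fract (g ^ l)) v0 = map_poly to_fract q0"
    "\<And>i. i \<in> I \<Longrightarrow> q i \<in> polys_s Y"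
    "\<And>i. i \<in> I \<Longrightarrow> smult (to_fract (g ^ l)) (v i) = map_poly to_fract (q i)"
    using clear_common_denominator[OF g I v] by metis
  have "map_poly to_fract (map_poly mconst d * (p0 * q0))
      = smult (to_fract (f ^ k) * to_fract (g ^ l)) (embed_s d * (u0 * v0))"
    by (simp add: embed_s_fract_poly mult_ac flip: p(2) q(2))
  also have "\<dots> = embed_s t * (\<Sum>i\<in>I. smult (to_fract (f ^ k)) (u i) * smult (to_fract (g ^ l)) (v i))"
    unfolding eq by (simp add: sum_distrib_left smult_sum_right mult_ac)
  also have "\<dots> = embed_s t * (\<Sum>i\<in>I. map_poly to_fract (p i * q i))"
    by (simp add: p(4) q(4))
  also have "\<dots> = map_poly to_fract (map_poly mconst t * (\<Sum>i\<in>I. p i * q i))"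
    by (simp add: embed_s_fract_poly fract_poly_sum)
  finally have E: "map_poly mconst d * (p0 * q0) = map_poly mconst t * (\<Sum>i\<in>I. p i * q i)"
    by (simp only: fract_poly_eq_iff)
  show ?thesis
  proof (intro exI conjI allI ballI impI)
    show "d * coeff_s m p0 * coeff_s n q0 = t * (\<Sum>i\<in>I. coeff_s m (p i) * coeff_s n (q i))"
      if "m \<in> {m. Poly_Mapping.keys m \<subseteq> X}" "n \<in> {n. Poly_Mapping.keys n \<subseteq> Y}" for m n
      using arg_cong[OF E, of "coeff_s (m + n)"] that p(1,3) q(1,3)
      by (simp add: coeff_s_const_mult coeff_s_sum coeff_s_mult_disjoint[OF XY] mult.assoc)
    show "embed_s e * u0 = embed_s t * (\<Sum>i\<in>I. embed_s (c i) * u i)"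
      if "\<forall>m\<in>{m. Poly_Mapping.keys m \<subseteq> X}. e * coeff_s m p0 = t * (\<Sum>i\<in>I. c i * coeff_s m (p i))"
      for e t c
      by (rule polys_s_relation[OF f(2) p]) (use that in auto)
    show "embed_s e * v0 = embed_s t * (\<Sum>i\<in>I. embed_s (c i) * v i)"
      if "\<forall>n\<in>{n. Poly_Mapping.keys n \<subseteq> Y}. e * coeff_s n q0 = t * (\<Sum>i\<in>I. c i * coeff_s n (q i))"
      for e t c
      by (rule polys_s_relation[OF g(2) q]) (use that in auto)
  qed
qed

text \<open>
  The alternative of \<open>prime_tensor_cancel\<close>, carried from coordinates back to the modules; with
  \<open>b\<^sub>f f\<^sup>s\<close> and \<open>b\<^sub>g g\<^sup>s\<close> for \<open>u0\<close> and \<open>v0\<close> it stands in for reduction modulo \<open>t\<close>.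
\<close>
lemma hs_module_prime_cancel:
  assumes XY: "X \<inter> Y = {}" and f: "f \<in> polys X" "f \<noteq> 0" and g: "g \<in> polys Y" "g \<noteq> 0"
    and I: "finite I"
    and u: "u0 \<in> hs_module X f" "\<forall>i\<in>I. u i \<in> hs_module X f"
    and v: "v0 \<in> hs_module Y g" "\<forall>i\<in>I. v i \<in> hs_module Y g"
    and t: "prime_elem t" and d: "\<not> t dvd d"
    and eq: "embed_s d * (u0 * v0) = embed_s t * (\<Sum>i\<in>I. u i * v i)"
  shows "(\<exists>e c. \<not> t dvd e \<and> embed_s e * u0 = embed_s t * (\<Sum>i\<in>I. embed_s (c i) * u i)) \<or>
    (\<exists>e c. \<not> t dvd e \<and> embed_s e * v0 = embed_s t * (\<Sum>i\<in>I. embed_s (c i) * v i))"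
proof -
  obtain M N :: "(nat \<Rightarrow>\<^sub>0 nat) set" and a0 b0 a b where
    rel: "\<forall>m\<in>M. \<forall>n\<in>N. d * a0 m * b0 n = t * (\<Sum>i\<in>I. a i m * b i n)"
    and U: "\<forall>e t c. (\<forall>m\<in>M. e * a0 m = t * (\<Sum>i\<in>I. c i * a i m)) \<longrightarrow>
      embed_s e * u0 = embed_s t * (\<Sum>i\<in>I. embed_s (c i) * u i)"
    and V: "\<forall>e t c. (\<forall>n\<in>N. e * b0 n = t * (\<Sum>i\<in>I. c i * b i n)) \<longrightarrow>
      embed_s e * v0 = embed_s t * (\<Sum>i\<in>I. embed_s (c i) * v i)"
    using hs_module_tensor_coordinates[OF XY f g I u v eq] by (elim exE conjE)
  have "(\<exists>e c. \<not> t dvd e \<and> (\<forall>m\<in>M. e * a0 m = t * (\<Sum>i\<in>I. c i * a i m))) \<or>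
    (\<exists>e c. \<not> t dvd e \<and> (\<forall>n\<in>N. e * b0 n = t * (\<Sum>i\<in>I. c i * b i n)))"
    using prime_tensor_cancel[of I t d M N a0 b0 a b] I t d rel by simp
  then show ?thesis
  proof (elim disjE exE conjE)
    fix e c assume "\<not> t dvd e" "\<forall>m\<in>M. e * a0 m = t * (\<Sum>i\<in>I. c i * a i m)"
    with U show ?thesis by blast
  next
    fix e c assume "\<not> t dvd e" "\<forall>n\<in>N. e * b0 n = t * (\<Sum>i\<in>I. c i * b i n)"
    with V show ?thesis by blast
  qed
qed


section \<open>The submodule generated by \<open>h\<^bsup>s+1\<^esup>\<close>\<close>

definition hs1_module :: "nat set \<Rightarrow> mpoly \<Rightarrow> mpoly fract poly set" where
  "hs1_module X h = {weyl_act h P [:to_fract h:] | P. P \<in> weyl_alg X}"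

lemma bernstein_eq_iff: "bernstein_eq X h b \<longleftrightarrow> embed_s b \<in> hs1_module X h"
  by (auto simp: bernstein_eq_def hs1_module_def)

lemma generator_in_hs1_module: "[:to_fract h:] \<in> hs1_module X h"
proof -
  have "[:to_fract h:] = weyl_act h (wconst 1) [:to_fract h:]" by (simp add: weyl_act_simps)
  then show ?thesis unfolding hs1_module_def by (blast intro: weyl_alg.const)
qed

lemma hs1_module_act:
  "P \<in> weyl_alg X \<Longrightarrow> u \<in> hs1_module X h \<Longrightarrow> weyl_act h P u \<in> hs1_module X h"
  unfolding hs1_module_def by (auto simp flip: weyl_act_mult intro: weyl_alg.mult)

lemma hs1_module_add:
  "u \<in> hs1_module X h \<Longrightarrow> v \<in> hs1_module X h \<Longrightarrow> u + v \<in> hs1_module X h"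
  unfolding hs1_module_def by (auto simp flip: weyl_act_add_left intro: weyl_alg.add)

lemma hs1_module_0: "0 \<in> hs1_module X h"
  using hs1_module_act[OF weyl_alg.const[where c = 0] generator_in_hs1_module[of h X]]
  by (simp add: weyl_act_simps)

lemma hs1_module_sum:
  "(\<And>i. i \<in> I \<Longrightarrow> u i \<in> hs1_module X h) \<Longrightarrow> (\<Sum>i\<in>I. u i) \<in> hs1_module X h"
  by (induction I rule: infinite_finite_induct) (simp_all add: hs1_module_0 hs1_module_add)

lemma hs1_module_embed_s_mult:
  assumes "u \<in> hs1_module X h"
  shows "embed_s c * u \<in> hs1_module X h"
proof (induction c)
  case 0
  show ?case by (simp add: hs1_module_0)
next
  case (pCons a c)
  have "embed_s (pCons a c) * u = weyl_act h (wconst a) u + weyl_act h wS (embed_s c * u)"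
    by (simp add: embed_s_pCons weyl_act_simps)
  with pCons assms show ?case
    by (auto intro!: hs1_module_add hs1_module_act weyl_alg.const weyl_alg.S)
qed

lemma hs1_module_subset:
  assumes "h \<in> polys X" "h \<noteq> 0"
  shows "hs1_module X h \<subseteq> hs_module X h"
proof -
  have "coeff [:to_fract h:] k \<in> localization X h" for k
    using assms localization_to_fract[OF polys_0, of X h]
    by (cases k) (auto intro: localization_to_fract)
  then show ?thesis using hs_module_act[OF assms]
    by (auto simp: hs1_module_def hs_module_def)
qed


section \<open>Products of modules in disjoint sets of variables\<close>

lemma fract_pderiv_sum: "fract_pderiv i (\<Sum>j\<in>J. x j) = (\<Sum>j\<in>J. fract_pderiv i (x j))"
  by (induction J rule: infinite_finite_induct) (simp_all add: fract_pderiv_add)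

lemma map_poly_fract_pderiv_mult:
  "map_poly (fract_pderiv i) (u * v)
    = map_poly (fract_pderiv i) u * v + u * map_poly (fract_pderiv i) v"
  by (rule poly_eqI)
    (simp add: coeff_map_poly coeff_mult fract_pderiv_sum fract_pderiv_mult sum.distrib)

text \<open>
  The Leibniz rule for \<open>u f\<^sup>s \<cdot> v g\<^sup>s = u v (f g)\<^sup>s\<close>: the logarithmic derivative of \<open>f g\<close> is the
  sum of those of \<open>f\<close> and \<open>g\<close>.
\<close>
lemma hs_deriv_mult:
  assumes "f \<noteq> 0" "g \<noteq> 0"
  shows "hs_deriv (f * g) i (u * v) = hs_deriv f i u * v + u * hs_deriv g i v"
proof -
  have "to_fract (mpderiv i (f * g)) / to_fract (f * g)
      = to_fract (mpderiv i f) / to_fract f + to_fract (mpderiv i g) / to_fract g"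
    using assms by (simp add: mpderiv_mult field_simps)
  then have "[:to_fract (mpderiv i (f * g)) / to_fract (f * g):]
      = [:to_fract (mpderiv i f) / to_fract f:] + [:to_fract (mpderiv i g) / to_fract g:]"
    by simp
  then show ?thesis
    unfolding hs_deriv_def map_poly_fract_pderiv_mult by (simp only: algebra_simps)
qed

lemma mpderiv_eq_0:
  assumes "p \<in> polys X" "i \<notin> X"
  shows "mpderiv i p = 0"
  using assms(1)
proof (induction rule: polys_induct)
  case (single m c)
  with assms(2) have "Poly_Mapping.lookup m i = 0" by (auto simp: in_keys_iff)
  then show ?case by (simp add: mpderiv_single)
qed simp

lemma hs_deriv_eq_0:
  assumes h: "h \<in> polys X" "h \<noteq> 0" and i: "i \<notin> X" and u: "u \<in> hs_module X h"
  shows "hs_deriv h i u = 0"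
proof -
  have "fract_pderiv i x = 0" if mem: "x \<in> localization X h" for x
  proof -
    obtain a k where a: "a \<in> polys X" and x: "x = to_fract a / to_fract h ^ k"
      using mem unfolding localization_def by blast
    have x: "x = Fract a (h ^ k)" by (simp add: x Fract_conv_to_fract to_fract_power)
    have "mpderiv i a = 0" "mpderiv i (h ^ k) = 0"
      using a h i by (auto intro: mpderiv_eq_0 polys_power)
    then show ?thesis using h unfolding x
      by (subst fract_pderiv_Fract) (simp_all add: Fract_conv_to_fract)
  qed
  then show ?thesis using u mpderiv_eq_0[OF h(1) i]
    by (intro poly_eqI) (simp add: coeff_hs_deriv hs_module_def)
qed

lemma weyl_act_mult_disjoint:
  assumes XY: "X \<inter> Y = {}" and f: "f \<in> polys X" "f \<noteq> 0" and g: "g \<in> polys Y" "g \<noteq> 0"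
    and v: "v \<in> hs_module Y g" and P: "P \<in> weyl_alg X"
  shows "weyl_act (f * g) P (u * v) = weyl_act f P u * v"
  using P
proof (induction arbitrary: u)
  case (deriv i)
  with XY have "hs_deriv g i v = 0" using hs_deriv_eq_0[OF g _ v] by blast
  then show ?case by (simp add: weyl_act_simps hs_deriv_mult f g)
next
  case (mult P Q)
  then show ?case by (simp only: weyl_act_mult)
qed (simp_all add: weyl_act_simps weyl_act_add_left algebra_simps)

inductive_set product_span :: "'a :: comm_ring set \<Rightarrow> 'a set \<Rightarrow> 'a set" for M N where
  zero: "0 \<in> product_span M N"
| step: "m \<in> M \<Longrightarrow> n \<in> N \<Longrightarrow> u \<in> product_span M N \<Longrightarrow> m * n + u \<in> product_span M N"

lemma product_span_add:
  "u \<in> product_span M N \<Longrightarrow> v \<in> product_span M N \<Longrightarrow> u + v \<in> product_span M N"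
  by (induction rule: product_span.induct) (auto simp: add.assoc intro: product_span.step)

lemma product_span_mult: "m \<in> M \<Longrightarrow> n \<in> N \<Longrightarrow> m * n \<in> product_span M N"
  using product_span.step[OF _ _ product_span.zero, of m M n N] by simp

lemma product_span_as_sum:
  assumes "u \<in> product_span M N"
  shows "\<exists>(k::nat) m n. (\<forall>i<k. m i \<in> M \<and> n i \<in> N) \<and> u = (\<Sum>i<k. m i * n i)"
  using assms
proof induction
  case zero
  show ?case by (rule exI[of _ 0]) simp
next
  case (step m' n' u)
  then obtain k :: nat and m n where
    *: "\<forall>i<k. m i \<in> M \<and> n i \<in> N" "u = (\<Sum>i<k. m i * n i)" by blast
  have "(\<Sum>i<k. (m(k := m')) i * (n(k := n')) i) = u"
    unfolding *(2) by (intro sum.cong) auto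
  then have "m' * n' + u = (\<Sum>i<Suc k. (m(k := m')) i * (n(k := n')) i)"
    by (simp add: add.commute)
  moreover have "\<forall>i<Suc k. (m(k := m')) i \<in> M \<and> (n(k := n')) i \<in> N"
    using * step by (auto simp: less_Suc_eq)
  ultimately show ?case by blast
qed

lemma product_span_linear_image:
  assumes "F 0 = 0" "\<And>u v. F (u + v) = F u + F v"
    and "\<And>m n. m \<in> M \<Longrightarrow> n \<in> N \<Longrightarrow> F (m * n) \<in> product_span M N"
    and "u \<in> product_span M N"
  shows "F u \<in> product_span M N"
  using assms(4)
  by induction (simp_all add: assms(1-3) product_span.zero product_span_add)

text \<open>
  The right-hand side contains the generator \<open>f g\<close> and is stable under operators in the
  variables \<open>X\<close>, which act on the first factors, and in the variables \<open>Y\<close>, which act on the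
  second ones; these generate the whole algebra.
\<close>
lemma hs1_module_product:
  assumes XY: "X \<inter> Y = {}" and f: "f \<in> polys X" "f \<noteq> 0" and g: "g \<in> polys Y" "g \<noteq> 0"
  shows "hs1_module (X \<union> Y) (f * g) \<subseteq> product_span (hs1_module X f) (hs1_module Y g)"
    (is "_ \<subseteq> ?T")
proof -
  have YX: "Y \<inter> X = {}" using XY by blast
  have X: "weyl_act (f * g) P u \<in> ?T" if "P \<in> weyl_alg X" "u \<in> ?T" for P u
    using that(2)
  proof (rule product_span_linear_image[rotated 3])
    show "weyl_act (f * g) P 0 = 0" using weyl_act_const[of "f * g" P 0 0] by simp
  next
    fix m n assume "m \<in> hs1_module X f" "n \<in> hs1_module Y g"
    with that(1) hs1_module_subset[OF g] show "weyl_act (f * g) P (m * n) \<in> ?T"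
      by (subst weyl_act_mult_disjoint[OF XY f g]) (auto intro: product_span_mult hs1_module_act)
  qed (rule weyl_act_add_right)
  have Y: "weyl_act (f * g) P u \<in> ?T" if "P \<in> weyl_alg Y" "u \<in> ?T" for P u
    using that(2)
  proof (rule product_span_linear_image[rotated 3])
    show "weyl_act (f * g) P 0 = 0" using weyl_act_const[of "f * g" P 0 0] by simp
  next
    fix m n assume mn: "m \<in> hs1_module X f" "n \<in> hs1_module Y g"
    have "weyl_act (f * g) P (m * n) = m * weyl_act g P n"
      using weyl_act_mult_disjoint[OF YX g f _ that(1), of m n] mn hs1_module_subset[OF f]
      by (auto simp: mult.commute)
    with mn that(1) show "weyl_act (f * g) P (m * n) \<in> ?T"
      by (auto intro: product_span_mult hs1_module_act)
  qed (rule weyl_act_add_right)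
  have "weyl_act (f * g) P u \<in> ?T" if "P \<in> weyl_alg (X \<union> Y)" "u \<in> ?T" for P u
    using that
  proof (induction arbitrary: u)
    case (add P Q)
    then show ?case by (simp add: weyl_act_add_left product_span_add)
  next
    case (mult P Q)
    then show ?case by (simp add: weyl_act_mult)
  qed (blast intro: X Y weyl_alg.intros)+
  moreover have "[:to_fract (f * g):] = [:to_fract f:] * [:to_fract g:]" by simp
  then have "[:to_fract (f * g):] \<in> ?T"
    by (metis product_span_mult generator_in_hs1_module)
  ultimately show ?thesis by (auto simp: hs1_module_def)
qed

lemma bernstein_eq_product:
  assumes XY: "X \<inter> Y = {}" and f: "f \<in> polys X" "f \<noteq> 0" and g: "g \<in> polys Y" "g \<noteq> 0"
    and b: "bernstein_eq X f b" and c: "bernstein_eq Y g c"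
  shows "bernstein_eq (X \<union> Y) (f * g) (b * c)"
proof -
  have YX: "Y \<inter> X = {}" using XY by blast
  obtain P where P: "P \<in> weyl_alg X" "embed_s b = weyl_act f P [:to_fract f:]"
    using b by (auto simp: bernstein_eq_def)
  obtain Q where Q: "Q \<in> weyl_alg Y" "embed_s c = weyl_act g Q [:to_fract g:]"
    using c by (auto simp: bernstein_eq_def)
  have mono: "weyl_alg Z \<subseteq> weyl_alg Z'" if "Z \<subseteq> Z'" for Z Z'
  proof
    show "R \<in> weyl_alg Z'" if "R \<in> weyl_alg Z" for R
      using that \<open>Z \<subseteq> Z'\<close> by induction (auto intro: weyl_alg.intros)
  qed
  have "embed_s (b * c) = weyl_act f P [:to_fract f:] * embed_s c"
    by (simp add: embed_s_mult P)
  also have "\<dots> = weyl_act (f * g) P ([:to_fract f:] * embed_s c)"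
    by (rule weyl_act_mult_disjoint[OF XY f g embed_s_in_hs_module P(1), symmetric])
  also have "[:to_fract f:] * embed_s c = weyl_act g Q [:to_fract g:] * [:to_fract f:]"
    by (simp only: Q(2) mult.commute)
  also have "\<dots> = weyl_act (g * f) Q ([:to_fract g:] * [:to_fract f:])"
    using generator_in_hs1_module hs1_module_subset[OF f]
    by (intro weyl_act_mult_disjoint[OF YX g f _ Q(1), symmetric]) blast
  also have "\<dots> = weyl_act (f * g) Q [:to_fract (f * g):]"
    by (simp add: mult.commute)
  finally have "embed_s (b * c) = weyl_act (f * g) (P * Q) [:to_fract (f * g):]"
    by (simp add: weyl_act_mult)
  moreover have "P * Q \<in> weyl_alg (X \<union> Y)"
    using P(1) Q(1) mono[of X "X \<union> Y"] mono[of Y "X \<union> Y"] by (auto intro: weyl_alg.mult)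
  ultimately show ?thesis unfolding bernstein_eq_def by blast
qed


section \<open>Multiplicativity of the Bernstein-Sato polynomial\<close>

lemma bernstein_sato_dvd:
  assumes b: "is_bernstein_sato X h b" and c: "bernstein_eq X h c"
  shows "b dvd c"
proof -
  have "embed_s (c div b * b) \<in> hs1_module X h"
    using b by (auto simp: embed_s_mult is_bernstein_sato_def bernstein_eq_iff
        intro: hs1_module_embed_s_mult)
  then have "bernstein_eq X h (c - c div b * b)"
    using c by (intro bernstein_eq_diff) (simp_all add: bernstein_eq_iff)
  then have "bernstein_eq X h (c mod b)" by (simp add: minus_div_mult_eq_mod)
  with b have "c mod b = 0"
    unfolding is_bernstein_sato_def by (metis degree_mod_less leD)
  then show ?thesis by (simp add: mod_eq_0_iff_dvd)
qed

lemma is_bernstein_sato_exists: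
  assumes "bernstein_eq X h c" "c \<noteq> 0"
  obtains b where "is_bernstein_sato X h b"
proof -
  obtain b where b: "b \<noteq> 0" "bernstein_eq X h b"
    "\<And>c. c \<noteq> 0 \<Longrightarrow> bernstein_eq X h c \<Longrightarrow> degree b \<le> degree c"
    using exists_least_iff[of "\<lambda>d. \<exists>c. c \<noteq> 0 \<and> bernstein_eq X h c \<and> degree c = d"] assms
    by (metis not_le)
  let ?a = "inverse (lead_coeff b)"
  have "embed_s ([:?a:] * b) \<in> hs1_module X h"
    using b(2) unfolding embed_s_mult bernstein_eq_iff by (rule hs1_module_embed_s_mult)
  then have "is_bernstein_sato X h (smult ?a b)"
    using b by (simp add: is_bernstein_sato_def bernstein_eq_iff)
  then show thesis by (rule that)
qed

text \<open>
  Division with remainder by \<open>t\<close> commutes with the extension of the coefficients from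
  \<open>\<complex>\<close> to the fraction field, so a quotient over the large field already has complex
  coefficients.
\<close>
lemma embed_s_division:
  assumes "embed_s c = embed_s t * u" and "t \<noteq> 0"
  obtains q where "c = t * q" and "u = embed_s q"
proof -
  have eq: "embed_s (c mod t) = embed_s t * (u - embed_s (c div t))"
  proof -
    have "embed_s c = embed_s t * embed_s (c div t) + embed_s (c mod t)"
      by (simp flip: embed_s_mult embed_s_add)
    with assms(1) show ?thesis by (simp add: algebra_simps)
  qed
  have "c mod t = 0"
  proof (rule ccontr)
    assume r: "c mod t \<noteq> 0"
    with eq have "u - embed_s (c div t) \<noteq> 0" by auto
    then have "degree (c mod t) \<ge> degree t"
      using arg_cong[OF eq, of degree] assms(2) by (simp add: degree_mult_eq degree_embed_s)
    with r assms(2) show False using degree_mod_less[of t c] by simp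
  qed
  with eq assms(2) have "u = embed_s (c div t)" by simp
  moreover have "c = t * (c div t)" using \<open>c mod t = 0\<close> by auto
  ultimately show thesis by (rule that[rotated])
qed

text \<open>
  Minimality of \<open>b\<close>, localised at \<open>t\<close>: if \<open>e b h\<^sup>s = t u\<close> with \<open>u \<in> N(h)\<close>, then \<open>u = q h\<^sup>s\<close>
  for a polynomial \<open>q\<close>, which \<open>b\<close> must divide; comparing \<open>e b = t q\<close> shows \<open>t\<close> divides \<open>e\<close>.
\<close>
lemma bernstein_sato_not_in_multiple:
  assumes b: "is_bernstein_sato X h b" and t: "prime_elem t" and e: "\<not> t dvd e"
    and u: "u \<in> hs1_module X h"
  shows "embed_s e * embed_s b \<noteq> embed_s t * u"
proof
  assume "embed_s e * embed_s b = embed_s t * u"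
  then obtain q where q: "e * b = t * q" "u = embed_s q"
    using embed_s_division[of "e * b" t u] t by (auto simp: embed_s_mult)
  with u have "bernstein_eq X h q" by (simp add: bernstein_eq_iff)
  with b have "b dvd q" by (rule bernstein_sato_dvd)
  then obtain r where "q = b * r" by (elim dvdE)
  with q have "b * e = b * (t * r)" by (simp add: mult_ac)
  moreover have "b \<noteq> 0" using b by (simp add: is_bernstein_sato_def)
  ultimately have "e = t * r" by simp
  with e show False by simp
qed

text \<open>
  Writing \<open>c\<close> as a sum of products from \<open>N(f)\<close> and \<open>N(g)\<close> and taking one coordinate of the
  second factors turns them into polynomials in \<open>s\<close>, and leaves a relation in \<open>N(f)\<close>. The
  coordinate is one at which \<open>1\<close>, which stands for \<open>g\<^sup>s\<close>, does not vanish.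
\<close>
lemma bernstein_eq_product_factor:
  assumes XY: "X \<inter> Y = {}" and f: "f \<in> polys X" "f \<noteq> 0" and g: "g \<in> polys Y" "g \<noteq> 0"
    and c: "bernstein_eq (X \<union> Y) (f * g) c" "c \<noteq> 0"
  obtains b where "bernstein_eq X f b" "b \<noteq> 0"
proof -
  obtain k :: nat and u v where
    u: "\<And>i. i < k \<Longrightarrow> u i \<in> hs1_module X f" and v: "\<And>i. i < k \<Longrightarrow> v i \<in> hs1_module Y g"
    and c_eq: "embed_s c = (\<Sum>i<k. u i * v i)"
    using product_span_as_sum[OF subsetD[OF hs1_module_product[OF XY f g]
          c(1)[unfolded bernstein_eq_iff]]] by blast
  have eq: "embed_s c * (1 * 1) = embed_s 1 * (\<Sum>i<k. u i * v i)"
    by (simp add: c_eq)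
  have one: "1 \<in> hs_module Z h" for Z h
    using embed_s_in_hs_module[of 1] by simp
  have u': "\<forall>i\<in>{..<k}. u i \<in> hs_module X f" and v': "\<forall>i\<in>{..<k}. v i \<in> hs_module Y g"
    using u v hs1_module_subset[OF f] hs1_module_subset[OF g] by auto
  obtain M N :: "(nat \<Rightarrow>\<^sub>0 nat) set" and a0 b0 a b where
    rel: "\<forall>m\<in>M. \<forall>n\<in>N. c * a0 m * b0 n = 1 * (\<Sum>i<k. a i m * b i n)"
    and U: "\<forall>e t c. (\<forall>m\<in>M. e * a0 m = t * (\<Sum>i<k. c i * a i m)) \<longrightarrow>
      embed_s e * 1 = embed_s t * (\<Sum>i<k. embed_s (c i) * u i)"
    and V: "\<forall>e t c. (\<forall>n\<in>N. e * b0 n = t * (\<Sum>i<k. c i * b i n)) \<longrightarrow>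
      embed_s e * 1 = embed_s t * (\<Sum>i<k. embed_s (c i) * v i)"
    using hs_module_tensor_coordinates[OF XY f g finite_lessThan one u' one v' eq]
    by (elim exE conjE)
  \<comment> \<open>If \<open>b0\<close> vanished identically, faithfulness of the coordinates would give \<open>1 = 0\<close>.\<close>
  obtain n where n: "n \<in> N" "b0 n \<noteq> 0"
    using V[rule_format, of 1 0 "\<lambda>_. 0"] by auto
  have "c * b0 n * a0 m = 1 * (\<Sum>i<k. b i n * a i m)" if "m \<in> M" for m
    using rel n(1) that by (simp add: mult_ac)
  then have "embed_s (c * b0 n) * 1 = embed_s 1 * (\<Sum>i<k. embed_s (b i n) * u i)"
    by (rule U[rule_format, where c = "\<lambda>i. b i n"])
  also have "\<dots> \<in> hs1_module X f"
    using u by (auto intro!: hs1_module_sum hs1_module_embed_s_mult)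
  finally have "bernstein_eq X f (c * b0 n)" by (simp add: bernstein_eq_iff)
  moreover have "c * b0 n \<noteq> 0" using n c(2) by simp
  ultimately show thesis by (rule that)
qed

text \<open>
  Cancelling the greatest common divisor leaves \<open>d * (a * b) = p * c\<close> with \<open>p\<close> and \<open>d\<close> coprime
  and \<open>p\<close> not a unit; a prime factor \<open>t\<close> of \<open>p\<close> is then prime to \<open>d\<close>, and
  \<open>hs_module_prime_cancel\<close> contradicts the minimality of \<open>a\<close> or of \<open>b\<close>.
\<close>
lemma bernstein_sato_product_dvd:
  assumes XY: "X \<inter> Y = {}" and f: "f \<in> polys X" "f \<noteq> 0" and g: "g \<in> polys Y" "g \<noteq> 0"
    and a: "is_bernstein_sato X f a" and b: "is_bernstein_sato Y g b"
    and c: "bernstein_eq (X \<union> Y) (f * g) c"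
  shows "a * b dvd c"
proof (rule ccontr)
  assume ndvd: "\<not> a * b dvd c"
  have "a * b \<noteq> 0" using a b by (simp add: is_bernstein_sato_def)
  define q where "q = gcd (a * b) c"
  with \<open>a * b \<noteq> 0\<close> have "q \<noteq> 0" by simp
  then obtain p d where p: "a * b = p * q" and d: "c = d * q" and cop: "coprime p d"
    using gcd_coprime_exists[of "a * b" c] unfolding q_def by blast
  have "\<not> is_unit p"
  proof
    assume "is_unit p"
    then have "p * q dvd d * q" by (simp add: unit_imp_dvd mult_dvd_mono)
    then have "a * b dvd c" by (simp only: p d)
    with ndvd show False ..
  qed
  moreover have "p \<noteq> 0" using p \<open>a * b \<noteq> 0\<close> by auto
  ultimately obtain t where t: "t dvd p" "prime t" using prime_divisor_exists by blast
  then obtain p' where p': "p = t * p'" by (elim dvdE)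
  have "\<not> t dvd d" using cop t by (meson coprime_common_divisor not_prime_unit)
  obtain k :: nat and u v where
    u: "\<And>i. i < k \<Longrightarrow> u i \<in> hs1_module X f" and v: "\<And>i. i < k \<Longrightarrow> v i \<in> hs1_module Y g"
    and c_eq: "embed_s c = (\<Sum>i<k. u i * v i)"
    using product_span_as_sum[OF subsetD[OF hs1_module_product[OF XY f g]
          c[unfolded bernstein_eq_iff]]] by blast
  have "d * (a * b) = p * c"
    by (simp only: p d mult_ac)
  then have "embed_s d * (embed_s a * embed_s b) = embed_s p * embed_s c"
    by (simp flip: embed_s_mult)
  then have eq: "embed_s d * (embed_s a * embed_s b)
      = embed_s t * (\<Sum>i<k. (embed_s p' * u i) * v i)"
    by (simp add: c_eq p' embed_s_mult sum_distrib_left mult_ac)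
  have u': "embed_s p' * u i \<in> hs1_module X f" if "i < k" for i
    using u[OF that] by (rule hs1_module_embed_s_mult)
  have fam: "\<forall>i\<in>{..<k}. embed_s p' * u i \<in> hs_module X f" "\<forall>i\<in>{..<k}. v i \<in> hs_module Y g"
    using u' v hs1_module_subset[OF f] hs1_module_subset[OF g] by auto
  have "prime_elem t" using \<open>prime t\<close> by (rule prime_imp_prime_elem)
  from hs_module_prime_cancel[OF XY f g finite_lessThan embed_s_in_hs_module fam(1)
      embed_s_in_hs_module fam(2) this \<open>\<not> t dvd d\<close> eq]
  consider e c where "\<not> t dvd e"
      "embed_s e * embed_s a = embed_s t * (\<Sum>i<k. embed_s (c i) * (embed_s p' * u i))"
    | e c where "\<not> t dvd e" "embed_s e * embed_s b = embed_s t * (\<Sum>i<k. embed_s (c i) * v i)"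
    by blast
  then show False
  proof cases
    case (1 e c)
    have "(\<Sum>i<k. embed_s (c i) * (embed_s p' * u i)) \<in> hs1_module X f"
      by (intro hs1_module_sum hs1_module_embed_s_mult[OF u']) simp
    with 1 bernstein_sato_not_in_multiple[OF a \<open>prime_elem t\<close>] show False by blast
  next
    case (2 e c)
    have "(\<Sum>i<k. embed_s (c i) * v i) \<in> hs1_module Y g"
      using v by (auto intro!: hs1_module_sum hs1_module_embed_s_mult)
    with 2 bernstein_sato_not_in_multiple[OF b \<open>prime_elem t\<close>] show False by blast
  qed
qed

theorem corollary1p4:
  fixes X Y :: "nat set" and f g :: mpoly
  assumes "finite X" and "finite Y" and "X \<inter> Y = {}"
    and "f \<in> polys X" and "g \<in> polys Y"
    and "f \<noteq> 0" and "g \<noteq> 0"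
  shows "bernstein_sato X f * bernstein_sato Y g = bernstein_sato (X \<union> Y) (f * g)"
proof (cases "\<exists>c. is_bernstein_sato (X \<union> Y) (f * g) c")
  case True
  then obtain c where c: "bernstein_eq (X \<union> Y) (f * g) c" "c \<noteq> 0"
    by (auto simp: is_bernstein_sato_def)
  obtain a where a: "is_bernstein_sato X f a"
    using bernstein_eq_product_factor[OF assms(3,4,6,5,7) c] is_bernstein_sato_exists by metis
  have "Y \<inter> X = {}" "bernstein_eq (Y \<union> X) (g * f) c"
    using assms(3) c by (auto simp: Un_commute mult.commute)
  then obtain b where b: "is_bernstein_sato Y g b"
    using bernstein_eq_product_factor[OF _ assms(5,7,4,6) _ c(2)] is_bernstein_sato_exists by metis
  have "is_bernstein_sato (X \<union> Y) (f * g) (a * b)"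
    unfolding is_bernstein_sato_def
  proof (intro conjI allI impI)
    show "a * b \<noteq> 0" "lead_coeff (a * b) = 1"
      using a b by (auto simp: is_bernstein_sato_def lead_coeff_mult)
    show "bernstein_eq (X \<union> Y) (f * g) (a * b)"
      using a b by (intro bernstein_eq_product assms) (auto simp: is_bernstein_sato_def)
    show "degree (a * b) \<le> degree d" if "d \<noteq> 0 \<and> bernstein_eq (X \<union> Y) (f * g) d" for d
      using that bernstein_sato_product_dvd[OF assms(3,4,6,5,7) a b]
      by (auto intro: dvd_imp_degree_le)
  qed
  then show ?thesis
    using a b by (simp add: bernstein_sato_eqI)
next
  case False
  have "\<not> ((\<exists>a. is_bernstein_sato X f a) \<and> (\<exists>b. is_bernstein_sato Y g b))"
  proof
    assume "(\<exists>a. is_bernstein_sato X f a) \<and> (\<exists>b. is_bernstein_sato Y g b)"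
    then obtain a b where "is_bernstein_sato X f a" "is_bernstein_sato Y g b" by blast
    then have "bernstein_eq (X \<union> Y) (f * g) (a * b)" "a * b \<noteq> 0"
      using assms by (auto simp: is_bernstein_sato_def intro: bernstein_eq_product)
    with False show False using is_bernstein_sato_exists by metis
  qed
  with False show ?thesis by (auto simp: bernstein_sato_def)
qed

end
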